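(* Let $\mathcal{B}(\Omega)$ be a Bergman-type space with Rudin–Forelli constant $\kappa$. Let $T$ be a linear operator defined a priori only on the linear span of the normalized reproducing kernels $\{k_z\}$ of $\mathcal{B}(\Omega)$, and assume there is a linear operator $T^*$ defined on the same span such that $\langle Tk_z,k_w\rangle=\langle k_z,T^*k_w\rangle$ for all $z,w\in\Omega$. If for some $p>\frac{4-\kappa}{2-\kappa}$ $$\sup_{z\in\Omega}\|U_zTk_z\|_{L^p(\Omega;d\sigma)}<\infty\quad\text{and}\quad\sup_{z\in\Omega}\|U_zT^*k_z\|_{L^p(\Omega;d\sigma)}<\infty,$$ then $T$ extends to a bounded operator on $\mathcal{B}(\Omega)$.
   Context: Notation: $A\lesssim B$ means $A\le CB$ for a constant $C$ independent of the relevant variables; $A\simeq B$ means $A\lesssim B$ and $B\lesssim A$. Bergman-type space: $\Omega\subset\mathbb{C}^n$ is a domain containing $0$ such that: (A.1) for each $z\in\Omega$ there is an involutive biholomorphic automorphism $\varphi_z$ of $\Omega$ with $\varphi_z(0)=z$; (A.2) there is a metric $d$ on $\Omega$ with $d(u,v)\simeq d(\varphi_z(u),\varphi_z(v))$ uniformly in $u,v,z$; $(\Omega,d)$ is separable and every closed $d$-ball is compact; $D(z,r)$ denotes the $d$-ball of center $z$ and radius $r$; (A.3) $\sigma$ is a finite Borel measure on $\Omega$, $\mathcal{B}(\Omega)$ is the space of holomorphic functions on $\Omega$ lying in $L^2(\Omega;d\sigma)$ with the $L^2(\sigma)$ norm $\|\cdot\|$ and inner product $\langle\cdot,\cdot\rangle$;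 $\mathcal{B}(\Omega)$ is a reproducing kernel Hilbert space with reproducing kernel $K_z$ ($f(z)=\langle f,K_z\rangle$) and normalized kernel $k_z=K_z/\|K_z\|$; $z\mapsto\|K_z\|$ is continuous on $(\Omega,d)$; (A.4) the measure $d\lambda(z):=\|K_z\|^2d\sigma(z)$ satisfies $\lambda(E)\simeq\lambda(\varphi_z(E))$ for Borel $E$, uniformly in $z$, and is doubling: $\lambda(D(z,2r))\le C\lambda(D(z,r))$ for all $z,r>0$; (A.5) $|\langle k_z,k_w\rangle|\simeq 1/\|K_{\varphi_z(w)}\|$ uniformly in $z,w$; (A.6) (Rudin–Forelli estimates) there is a constant $\kappa\in[0,2)$ such that, if $\kappa>0$, for all $r>\kappa>s>0$ one has $\sup_{z\in\Omega}\int_\Omega \frac{|\langle K_z,K_w\rangle|^{(r+s)/2}}{\|K_z\|^s\|K_w\|^r}d\lambda(w)<\infty$, and if $\kappa=0$ this holds for all $r=s>0$; (A.7) $\|K_z\|\to\infty$ as $d(z,0)\to\infty$. Translation operators: $U_zf(w):=f(\varphi_z(w))k_z(w)$ for $z\in\Omega$. *)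

theory Defs
  imports "HOL-Analysis.Analysis"
begin

definition holo_on :: "(complex^'n::finite) set \<Rightarrow> (complex^'n \<Rightarrow> complex) \<Rightarrow> bool" where
  "holo_on \<Omega> f \<longleftrightarrow> (\<forall>x\<in>\<Omega>. \<exists>L. (f has_derivative L) (at x) \<and>
                        (\<forall>c v. L (c *s v) = c * L v))"

definition holo_map_on :: "(complex^'n::finite) set \<Rightarrow> (complex^'n \<Rightarrow> complex^'m::finite) \<Rightarrow> bool" where
  "holo_map_on \<Omega> F \<longleftrightarrow> (\<forall>i. holo_on \<Omega> (\<lambda>w. F w $ i))"

definition L2inner :: "'a measure \<Rightarrow> ('a \<Rightarrow> complex) \<Rightarrow> ('a \<Rightarrow> complex) \<Rightarrow> complex" where
  "L2inner \<sigma> f g = integral\<^sup>L \<sigma> (\<lambda>x. f x * cnj (g x))"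

definition L2norm :: "'a measure \<Rightarrow> ('a \<Rightarrow> complex) \<Rightarrow> real" where
  "L2norm \<sigma> f = sqrt (integral\<^sup>L \<sigma> (\<lambda>x. (cmod (f x))\<^sup>2))"

text \<open>The space B(Omega): holomorphic functions on Omega lying in L^2(sigma).
Functions are represented as maps on all of C^n vanishing off Omega
(sigma is carried by Omega).\<close>
definition Bspace :: "(complex^'n::finite) set \<Rightarrow> (complex^'n) measure \<Rightarrow> (complex^'n \<Rightarrow> complex) set" where
  "Bspace \<Omega> \<sigma> = {f. holo_on \<Omega> f \<and> (\<forall>x. x \<notin> \<Omega> \<longrightarrow> f x = 0) \<and>
                     f \<in> borel_measurable \<sigma> \<and> integrable \<sigma> (\<lambda>x. (cmod (f x))\<^sup>2)}"

definition nkernel :: "'a measure \<Rightarrow> ('b \<Rightarrow> 'a \<Rightarrow> complex) \<Rightarrow> 'b \<Rightarrow> 'a \<Rightarrow> complex" where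
  "nkernel \<sigma> K z = (\<lambda>x. K z x / complex_of_real (L2norm \<sigma> (K z)))"

definition transl :: "'a measure \<Rightarrow> ('a \<Rightarrow> 'a \<Rightarrow> complex) \<Rightarrow> ('a \<Rightarrow> 'a \<Rightarrow> 'a) \<Rightarrow> 'a
                       \<Rightarrow> ('a \<Rightarrow> complex) \<Rightarrow> 'a \<Rightarrow> complex" where
  "transl \<sigma> K \<phi> z f = (\<lambda>w. f (\<phi> z w) * nkernel \<sigma> K z w)"

definition lam :: "'a measure \<Rightarrow> ('a \<Rightarrow> 'a \<Rightarrow> complex) \<Rightarrow> 'a measure" where
  "lam \<sigma> K = density \<sigma> (\<lambda>z. ennreal ((L2norm \<sigma> (K z))\<^sup>2))"

definition kspan :: "'a set \<Rightarrow> 'a measure \<Rightarrow> ('a \<Rightarrow> 'a \<Rightarrow> complex) \<Rightarrow> ('a \<Rightarrow> complex) set" where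
  "kspan \<Omega> \<sigma> K = {f. \<exists>S c. finite S \<and> S \<subseteq> \<Omega> \<and>
                       f = (\<lambda>x. \<Sum>z\<in>S. c z * nkernel \<sigma> K z x)}"

definition dball :: "'a set \<Rightarrow> ('a \<Rightarrow> 'a \<Rightarrow> real) \<Rightarrow> 'a \<Rightarrow> real \<Rightarrow> 'a set" where
  "dball \<Omega> d z r = {w\<in>\<Omega>. d z w < r}"

definition bergman_type ::
  "(complex^'n::finite) set \<Rightarrow> (complex^'n \<Rightarrow> complex^'n \<Rightarrow> complex^'n)
   \<Rightarrow> (complex^'n \<Rightarrow> complex^'n \<Rightarrow> real) \<Rightarrow> (complex^'n) measure
   \<Rightarrow> (complex^'n \<Rightarrow> complex^'n \<Rightarrow> complex) \<Rightarrow> real \<Rightarrow> bool" where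
  "bergman_type \<Omega> \<phi> d \<sigma> K \<kappa> \<longleftrightarrow>
    \<comment> \<open>Omega is a domain containing 0\<close>
    open \<Omega> \<and> connected \<Omega> \<and> 0 \<in> \<Omega> \<and>
    \<comment> \<open>(A.1) involutive biholomorphic automorphisms phi_z with phi_z(0) = z\<close>
    (\<forall>z\<in>\<Omega>. \<phi> z ` \<Omega> = \<Omega> \<and> (\<forall>w\<in>\<Omega>. \<phi> z (\<phi> z w) = w) \<and>
             holo_map_on \<Omega> (\<phi> z) \<and> \<phi> z 0 = z) \<and>
    \<comment> \<open>(A.2) metric d, quasi-invariant, separable, closed balls compact\<close>
    Metric_space \<Omega> d \<and>
    (\<exists>C>0. \<forall>z\<in>\<Omega>. \<forall>u\<in>\<Omega>. \<forall>v\<in>\<Omega>.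
        d u v \<le> C * d (\<phi> z u) (\<phi> z v) \<and> d (\<phi> z u) (\<phi> z v) \<le> C * d u v) \<and>
    separable_space (Metric_space.mtopology \<Omega> d) \<and>
    (\<forall>z\<in>\<Omega>. \<forall>r. compactin (Metric_space.mtopology \<Omega> d) (Metric_space.mcball \<Omega> d z r)) \<and>
    \<comment> \<open>(A.3) finite Borel measure on Omega; RKHS structure\<close>
    sets \<sigma> = sets borel \<and> finite_measure \<sigma> \<and> emeasure \<sigma> (UNIV - \<Omega>) = 0 \<and>
    (\<forall>f. (\<forall>n. f n \<in> Bspace \<Omega> \<sigma>) \<longrightarrow>
         (\<forall>e>0. \<exists>N. \<forall>m\<ge>N. \<forall>n\<ge>N. L2norm \<sigma> (\<lambda>x. f m x - f n x) < e) \<longrightarrow>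
         (\<exists>g\<in>Bspace \<Omega> \<sigma>. (\<lambda>n. L2norm \<sigma> (\<lambda>x. f n x - g x)) \<longlonglongrightarrow> 0)) \<and>
    (\<forall>z\<in>\<Omega>. K z \<in> Bspace \<Omega> \<sigma>) \<and>
    (\<forall>z\<in>\<Omega>. \<forall>f\<in>Bspace \<Omega> \<sigma>. f z = L2inner \<sigma> f (K z)) \<and>
    (\<forall>z\<in>\<Omega>. \<forall>e>0. \<exists>\<delta>>0. \<forall>w\<in>\<Omega>. d z w < \<delta> \<longrightarrow>
        \<bar>L2norm \<sigma> (K w) - L2norm \<sigma> (K z)\<bar> < e) \<and>
    \<comment> \<open>(A.4) quasi-invariance and doubling of lambda\<close>
    (\<exists>C>0. \<forall>z\<in>\<Omega>. \<forall>E\<in>sets borel. E \<subseteq> \<Omega> \<longrightarrow>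
        emeasure (lam \<sigma> K) E \<le> ennreal C * emeasure (lam \<sigma> K) (\<phi> z ` E) \<and>
        emeasure (lam \<sigma> K) (\<phi> z ` E) \<le> ennreal C * emeasure (lam \<sigma> K) E) \<and>
    (\<exists>C. \<forall>z\<in>\<Omega>. \<forall>r>0.
        emeasure (lam \<sigma> K) (dball \<Omega> d z (2 * r)) \<le> ennreal C * emeasure (lam \<sigma> K) (dball \<Omega> d z r)) \<and>
    \<comment> \<open>(A.5)\<close>
    (\<exists>C>0. \<forall>z\<in>\<Omega>. \<forall>w\<in>\<Omega>.
        cmod (L2inner \<sigma> (nkernel \<sigma> K z) (nkernel \<sigma> K w)) \<le> C / L2norm \<sigma> (K (\<phi> z w)) \<and>
        1 / L2norm \<sigma> (K (\<phi> z w)) \<le> C * cmod (L2inner \<sigma> (nkernel \<sigma> K z) (nkernel \<sigma> K w))) \<and>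
    \<comment> \<open>(A.6) Rudin--Forelli estimates with constant kappa\<close>
    0 \<le> \<kappa> \<and> \<kappa> < 2 \<and>
    (\<forall>r s. (if \<kappa> > 0 then r > \<kappa> \<and> \<kappa> > s \<and> s > 0 else r = s \<and> s > 0) \<longrightarrow>
       (\<exists>M. \<forall>z\<in>\<Omega>.
          (\<integral>\<^sup>+ w. ennreal (cmod (L2inner \<sigma> (K z) (K w)) powr ((r + s) / 2)
                     / (L2norm \<sigma> (K z) powr s * L2norm \<sigma> (K w) powr r)) \<partial>(lam \<sigma> K))
          \<le> ennreal M)) \<and>
    \<comment> \<open>(A.7) ||K_z|| tends to infinity as d(z,0) tends to infinity\<close>
    (\<forall>M. \<exists>R. \<forall>z\<in>\<Omega>. d z 0 > R \<longrightarrow> L2norm \<sigma> (K z) > M)"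

end

theory Submission
  imports Defs
begin

text \<open>
  Write \<open>F(z, w)\<close> for \<open>\<langle>T K\<^sub>w, K\<^sub>z\<rangle>\<close>, which equals \<open>\<langle>K\<^sub>w, T\<^sup>* K\<^sub>z\<rangle>\<close>. On the span of the kernels, \<open>T\<close> is the integral
  operator with kernel \<open>F\<close>, and Schur's test with weight \<open>\<parallel>K\<^sub>z\<parallel>\<^sup>\<alpha>\<close> bounds it. For the row and column
  estimates, the quasi-invariance of \<open>\<lambda>\<close> turns the hypothesis on \<open>U\<^sub>z T k\<^sub>z\<close> into a weighted
  \<open>L\<^sup>p(\<lambda>)\<close> bound for \<open>T k\<^sub>z\<close>; with the conjugate exponent \<open>q\<close>, the complementary \<open>L\<^sup>q\<close> factor is a
  Rudin--Forelli integral with \<open>r = 2 - q \<alpha>\<close> and \<open>s = 2 - 2 q + q \<alpha>\<close>. An admissible \<open>\<alpha>\<close> exists exactly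
  because \<open>p > (4 - \<kappa>) / (2 - \<kappa>)\<close>. Since the kernels span a dense subspace, the extension is
  \<open>S f(z) = \<langle>f, T\<^sup>* K\<^sub>z\<rangle>\<close>.
\<close>

section \<open>Square-integrable functions\<close>

text \<open>Functions themselves, not classes modulo null sets, so that point evaluations keep their
  meaning; \<open>L2norm\<close> is then only a seminorm.\<close>

definition Lsq :: "'a measure \<Rightarrow> ('a \<Rightarrow> complex) set" where
  "Lsq M = {f. f \<in> borel_measurable M \<and> integrable M (\<lambda>x. (cmod (f x))\<^sup>2)}"

lemma Lsq_measurable: "f \<in> Lsq M \<Longrightarrow> f \<in> borel_measurable M"
  by (simp add: Lsq_def)

lemma Lsq_lincomb:
  assumes "f \<in> Lsq M" "g \<in> Lsq M"
  shows "(\<lambda>x. a * f x + b * g x) \<in> Lsq M"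
proof -
  have [measurable]: "f \<in> borel_measurable M" "g \<in> borel_measurable M"
    using assms by (auto simp: Lsq_def)
  have "integrable M (\<lambda>x. (cmod (a * f x + b * g x))\<^sup>2)"
  proof (rule Bochner_Integration.integrable_bound)
    show "integrable M (\<lambda>x. 2 * (cmod a)\<^sup>2 * (cmod (f x))\<^sup>2 + 2 * (cmod b)\<^sup>2 * (cmod (g x))\<^sup>2)"
      using assms by (auto simp: Lsq_def)
    show "AE x in M. norm ((cmod (a * f x + b * g x))\<^sup>2)
        \<le> norm (2 * (cmod a)\<^sup>2 * (cmod (f x))\<^sup>2 + 2 * (cmod b)\<^sup>2 * (cmod (g x))\<^sup>2)"
    proof (rule AE_I2)
      fix x
      have "(cmod (a * f x + b * g x))\<^sup>2 \<le> (cmod (a * f x) + cmod (b * g x))\<^sup>2"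
        by (intro power_mono norm_triangle_ineq) auto
      also have "\<dots> \<le> 2 * (cmod (a * f x))\<^sup>2 + 2 * (cmod (b * g x))\<^sup>2"
        using sum_squares_ge_zero[of "cmod (a * f x) - cmod (b * g x)" 0]
        by (simp add: power2_eq_square algebra_simps)
      finally show "norm ((cmod (a * f x + b * g x))\<^sup>2)
        \<le> norm (2 * (cmod a)\<^sup>2 * (cmod (f x))\<^sup>2 + 2 * (cmod b)\<^sup>2 * (cmod (g x))\<^sup>2)"
        by (simp add: norm_mult power_mult_distrib)
    qed
  qed simp
  then show ?thesis by (simp add: Lsq_def)
qed

lemma Lsq_diff: "f \<in> Lsq M \<Longrightarrow> g \<in> Lsq M \<Longrightarrow> (\<lambda>x. f x - g x) \<in> Lsq M"
  using Lsq_lincomb[of f M g 1 "-1"] by simp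

lemma borel_measurable_cnj [measurable]: "cnj \<in> borel_measurable borel"
  by (intro borel_measurable_continuous_onI continuous_intros)

lemma integrable_mult_cnj:
  assumes "f \<in> Lsq M" "g \<in> Lsq M"
  shows "integrable M (\<lambda>x. f x * cnj (g x))"
proof (rule Bochner_Integration.integrable_bound)
  show "integrable M (\<lambda>x. (cmod (f x))\<^sup>2 + (cmod (g x))\<^sup>2)"
    using assms by (auto simp: Lsq_def)
  show "(\<lambda>x. f x * cnj (g x)) \<in> borel_measurable M"
    using assms[THEN Lsq_measurable] by measurable
  show "AE x in M. norm (f x * cnj (g x)) \<le> norm ((cmod (f x))\<^sup>2 + (cmod (g x))\<^sup>2)"
  proof (rule AE_I2)
    fix x
    have "2 * (cmod (f x) * cmod (g x)) \<le> (cmod (f x))\<^sup>2 + (cmod (g x))\<^sup>2"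
      using sum_squares_bound[of "cmod (f x)" "cmod (g x)"] by simp
    moreover have "0 \<le> cmod (f x) * cmod (g x)" by simp
    ultimately have "cmod (f x) * cmod (g x) \<le> (cmod (f x))\<^sup>2 + (cmod (g x))\<^sup>2" by linarith
    then show "norm (f x * cnj (g x)) \<le> norm ((cmod (f x))\<^sup>2 + (cmod (g x))\<^sup>2)"
      by (simp add: norm_mult)
  qed
qed

lemma L2inner_lincomb_left:
  assumes "f \<in> Lsq M" "g \<in> Lsq M" "h \<in> Lsq M"
  shows "L2inner M (\<lambda>x. a * f x + b * g x) h = a * L2inner M f h + b * L2inner M g h"
proof -
  have "(\<lambda>x. (a * f x + b * g x) * cnj (h x))
      = (\<lambda>x. a * (f x * cnj (h x)) + b * (g x * cnj (h x)))"
    by (simp add: algebra_simps)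
  then show ?thesis
    unfolding L2inner_def using assms by (simp add: integrable_mult_cnj)
qed

lemma L2inner_diff_left:
  assumes "f \<in> Lsq M" "g \<in> Lsq M" "h \<in> Lsq M"
  shows "L2inner M (\<lambda>x. f x - g x) h = L2inner M f h - L2inner M g h"
  using L2inner_lincomb_left[OF assms, of 1 "-1"] by simp

lemma L2inner_commute: "L2inner M g f = cnj (L2inner M f g)"
proof -
  have "L2inner M g f = integral\<^sup>L M (\<lambda>x. cnj (f x * cnj (g x)))"
    by (simp add: L2inner_def algebra_simps)
  then show ?thesis unfolding L2inner_def using Bochner_Integration.integral_cnj[of M "\<lambda>x. f x * cnj (g x)"] by simp
qed

lemma L2norm_nonneg [simp]: "0 \<le> L2norm M f"
  by (simp add: L2norm_def)

lemma L2norm_square: "(L2norm M f)\<^sup>2 = integral\<^sup>L M (\<lambda>x. (cmod (f x))\<^sup>2)"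
  by (simp add: L2norm_def)

lemma L2inner_self: "L2inner M f f = complex_of_real ((L2norm M f)\<^sup>2)"
  unfolding L2norm_square L2inner_def
  by (subst integral_complex_of_real[symmetric]) (simp add: complex_norm_square[symmetric])

lemma nn_integral_L2norm:
  assumes "f \<in> Lsq M"
  shows "(\<integral>\<^sup>+x. ennreal ((cmod (f x))\<^sup>2) \<partial>M) = ennreal ((L2norm M f)\<^sup>2)"
  unfolding L2norm_square using assms
  by (intro nn_integral_eq_integral) (auto simp: Lsq_def)

text \<open>Polarization with two complex coefficients. Cauchy--Schwarz, the triangle inequality,
  the projection onto a unit vector and the parallelogram argument for the span are all instances of
  it.\<close>

lemma L2norm_square_lincomb:
  assumes "f \<in> Lsq M" "g \<in> Lsq M"
  shows "(L2norm M (\<lambda>x. a * f x + b * g x))\<^sup>2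
    = (cmod a)\<^sup>2 * (L2norm M f)\<^sup>2 + (cmod b)\<^sup>2 * (L2norm M g)\<^sup>2 + 2 * Re (a * cnj b * L2inner M f g)"
proof -
  let ?h = "\<lambda>x. a * f x + b * g x"
  have h: "?h \<in> Lsq M" by (rule Lsq_lincomb[OF assms])
  have 1: "L2inner M u ?h = cnj a * L2inner M u f + cnj b * L2inner M u g" if "u \<in> Lsq M" for u
  proof -
    have "L2inner M u ?h = cnj (L2inner M ?h u)" by (rule L2inner_commute)
    also have "\<dots> = cnj a * cnj (L2inner M f u) + cnj b * cnj (L2inner M g u)"
      using L2inner_lincomb_left[OF assms that] by simp
    finally show ?thesis by (simp only: L2inner_commute[symmetric])
  qed
  have "L2inner M ?h ?h = a * (cnj a * L2inner M f f + cnj b * L2inner M f g)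
      + b * (cnj a * L2inner M g f + cnj b * L2inner M g g)"
    using L2inner_lincomb_left[OF assms h, of a b] 1 assms by simp
  then have "complex_of_real ((L2norm M ?h)\<^sup>2) =
      a * cnj a * complex_of_real ((L2norm M f)\<^sup>2) + b * cnj b * complex_of_real ((L2norm M g)\<^sup>2)
      + (a * cnj b * L2inner M f g + cnj (a * cnj b * L2inner M f g))"
    unfolding L2inner_self L2inner_commute[of M g f] by (simp add: algebra_simps)
  also have "\<dots> = complex_of_real ((cmod a)\<^sup>2 * (L2norm M f)\<^sup>2 + (cmod b)\<^sup>2 * (L2norm M g)\<^sup>2
      + 2 * Re (a * cnj b * L2inner M f g))"
    unfolding complex_add_cnj complex_norm_square[symmetric] by simp
  finally show ?thesis by (simp only: of_real_eq_iff)
qed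

lemma L2norm_mult: "L2norm M (\<lambda>x. a * f x) = cmod a * L2norm M f"
  unfolding L2norm_def by (simp add: norm_mult power_mult_distrib real_sqrt_mult)

lemma L2norm_minus_commute: "L2norm M (\<lambda>x. f x - g x) = L2norm M (\<lambda>x. g x - f x)"
  by (simp add: L2norm_def norm_minus_commute)

text \<open>Pythagoras, the inner product times \<open>g\<close> being the projection of
  \<open>f\<close> onto the unit vector \<open>g\<close>. In the density argument it measures what
  one more kernel gains in distance.\<close>

lemma L2norm_square_residual:
  assumes "f \<in> Lsq M" "g \<in> Lsq M" "L2norm M g = 1"
  shows "(L2norm M (\<lambda>x. 1 * f x + (- L2inner M f g) * g x))\<^sup>2
      = (L2norm M f)\<^sup>2 - (cmod (L2inner M f g))\<^sup>2"
proof -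
  let ?c = "L2inner M f g"
  have "Re (1 * cnj (- ?c) * ?c) = - (cmod ?c)\<^sup>2"
    unfolding cmod_power2 by (simp add: power2_eq_square)
  then show ?thesis
    unfolding L2norm_square_lincomb[OF assms(1,2)] by (simp add: assms(3))
qed

lemma L2_Cauchy_Schwarz:
  assumes f: "f \<in> Lsq M" and g: "g \<in> Lsq M"
  shows "cmod (L2inner M f g) \<le> L2norm M f * L2norm M g"
proof -
  let ?c = "L2inner M f g"
  \<comment> \<open>The squared norm of \<open>f - t c g\<close> with c the inner product of
    \<open>f\<close> and \<open>g\<close>. Putting c into the coefficient takes care of its phase,
    so a real polynomial in \<open>t\<close> remains.\<close>
  have *: "0 \<le> (L2norm M f)\<^sup>2 + t\<^sup>2 * (cmod ?c)\<^sup>2 * (L2norm M g)\<^sup>2 - 2 * t * (cmod ?c)\<^sup>2" for t :: real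
  proof -
    have "Re (1 * cnj (- (of_real t * ?c)) * ?c) = - t * (cmod ?c)\<^sup>2"
      unfolding cmod_power2 by (simp add: power2_eq_square algebra_simps)
    then have "(L2norm M (\<lambda>x. 1 * f x + (- (of_real t * ?c)) * g x))\<^sup>2 =
      (L2norm M f)\<^sup>2 + t\<^sup>2 * (cmod ?c)\<^sup>2 * (L2norm M g)\<^sup>2 - 2 * t * (cmod ?c)\<^sup>2"
      unfolding L2norm_square_lincomb[OF f g] by (simp add: norm_mult power_mult_distrib)
    then show ?thesis by (metis zero_le_power2)
  qed
  show ?thesis
  proof (cases "L2norm M g = 0")
    case True
    have "cmod ?c = 0"
    proof (rule ccontr)
      assume "cmod ?c \<noteq> 0"
      then have "(cmod ?c)\<^sup>2 > 0" by simp
      \<comment> \<open>With \<open>L2norm M g = 0\<close> the polynomial is affine in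
        \<open>t\<close>, and this choice of \<open>t\<close> gives it the value -1.\<close>
      then show False
        using *[of "((L2norm M f)\<^sup>2 + 1) / (2 * (cmod ?c)\<^sup>2)"] True by (simp add: field_simps)
    qed
    then show ?thesis by simp
  next
    case False
    then have pos: "(L2norm M g)\<^sup>2 > 0" by simp
    have "(cmod ?c)\<^sup>2 \<le> (L2norm M f)\<^sup>2 * (L2norm M g)\<^sup>2"
    proof -
      \<comment> \<open>The polynomial attains its minimum at
        \<open>t = 1 / (L2norm M g)^2\<close>.\<close>
      have "(1 / (L2norm M g)\<^sup>2)\<^sup>2 * (cmod ?c)\<^sup>2 * (L2norm M g)\<^sup>2 = (cmod ?c)\<^sup>2 / (L2norm M g)\<^sup>2"
        using pos by (simp add: power2_eq_square)
      then have "(cmod ?c)\<^sup>2 / (L2norm M g)\<^sup>2 \<le> (L2norm M f)\<^sup>2"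
        using *[of "1 / (L2norm M g)\<^sup>2"] by simp
      then show ?thesis using pos by (simp add: divide_le_eq)
    qed
    then have "(cmod ?c)\<^sup>2 \<le> (L2norm M f * L2norm M g)\<^sup>2" by (simp add: power_mult_distrib)
    then show ?thesis by (rule power2_le_imp_le) simp
  qed
qed

lemma L2norm_triangle:
  assumes f: "f \<in> Lsq M" and g: "g \<in> Lsq M"
  shows "L2norm M (\<lambda>x. f x + g x) \<le> L2norm M f + L2norm M g"
proof (rule power2_le_imp_le)
  have "Re (L2inner M f g) \<le> L2norm M f * L2norm M g"
    using L2_Cauchy_Schwarz[OF f g] complex_Re_le_cmod[of "L2inner M f g"] by linarith
  then show "(L2norm M (\<lambda>x. f x + g x))\<^sup>2 \<le> (L2norm M f + L2norm M g)\<^sup>2"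
    using L2norm_square_lincomb[OF f g, of 1 1] by (simp add: power2_sum)
qed simp

text \<open>A Caratheodory function is approximated by its values along a dense sequence, chosen
  measurably in the continuous variable.\<close>

lemma borel_measurable_pair_continuous:
  fixes f :: "'a::{second_countable_topology,metric_space} \<Rightarrow> 'b \<Rightarrow> 'c::metric_space"
  assumes "open X" "X \<noteq> {}"
    and cont: "\<And>y. y \<in> space M \<Longrightarrow> continuous_on X (\<lambda>x. f x y)"
    and meas: "\<And>x. x \<in> X \<Longrightarrow> f x \<in> borel_measurable M"
  shows "(\<lambda>(x, y). if x \<in> X then f x y else c) \<in> borel_measurable (borel \<Otimes>\<^sub>M M)"
proof -
  obtain D :: "'a set" where "countable D" and D: "\<And>U. open U \<Longrightarrow> U \<noteq> {} \<Longrightarrow> \<exists>d\<in>D. d \<in> U"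
    by (rule countable_dense_setE) blast
  have ne: "D \<inter> X \<noteq> {}" using D[OF assms(1,2)] by auto
  \<comment> \<open>Only points of \<open>X\<close> are enumerated, because \<open>f x\<close> is
    assumed measurable for these alone.\<close>
  define e where "e = from_nat_into (D \<inter> X)"
  have eX: "e i \<in> X" for i
    using from_nat_into[OF ne] by (simp add: e_def)
  have dense: "\<exists>i. dist x (e i) < inverse (real (Suc n))" if "x \<in> X" for x n
  proof -
    have "open (X \<inter> ball x (inverse (real (Suc n))))" "X \<inter> ball x (inverse (real (Suc n))) \<noteq> {}"
      using assms(1) that by (auto intro!: exI[of _ x])
    from D[OF this] obtain d where "d \<in> D \<inter> X" "dist x d < inverse (real (Suc n))" by auto
    moreover have "range e = D \<inter> X"
      unfolding e_def using \<open>countable D\<close> ne by (intro range_from_nat_into) auto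
    ultimately show ?thesis by (metis imageE)
  qed
  \<comment> \<open>Taking the least admissible index makes the choice a Borel map into the natural
    numbers; the composite with \<open>f\<close> is then measurable because only countably many
    sections occur.\<close>
  define s where "s = (\<lambda>n x. LEAST i. dist x (e i) < inverse (real (Suc n)))"
  have s_prop: "dist x (e (s n x)) < inverse (real (Suc n))" if "x \<in> X" for x n
    unfolding s_def by (rule LeastI_ex) (rule dense[OF that])
  have [measurable]: "s n \<in> measurable borel (count_space UNIV)" for n
    unfolding s_def by measurable
  have [measurable]: "X \<in> sets borel" using assms(1) by simp
  have [measurable]: "f (e i) \<in> borel_measurable M" for i using meas eX by simp
  show ?thesis
  proof (rule borel_measurable_LIMSEQ_metric)
    fix n
    have "(\<lambda>p. f (e (s n (fst p))) (snd p)) \<in> borel_measurable (borel \<Otimes>\<^sub>M M)"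
      by (rule measurable_compose_countable[where f="\<lambda>i p. f (e i) (snd p)" and g="\<lambda>p. s n (fst p)"])
        measurable
    then show "(\<lambda>p. if fst p \<in> X then f (e (s n (fst p))) (snd p) else c) \<in> borel_measurable (borel \<Otimes>\<^sub>M M)"
      by measurable
  next
    fix p :: "'a \<times> 'b" assume "p \<in> space (borel \<Otimes>\<^sub>M M)"
    then obtain x y where p: "p = (x, y)" "y \<in> space M" by (auto simp: space_pair_measure)
    have "(\<lambda>n. f (e (s n x)) y) \<longlonglongrightarrow> f x y" if "x \<in> X"
    proof -
      have "(\<lambda>n. e (s n x)) \<longlonglongrightarrow> x"
      proof (rule metric_LIMSEQ_I)
        fix r :: real assume "r > 0"
        then obtain n0 where n0: "inverse (real (Suc n0)) < r"
          using reals_Archimedean by blast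
        have "dist (e (s n x)) x < r" if "n \<ge> n0" for n
        proof -
          have "inverse (real (Suc n)) \<le> inverse (real (Suc n0))" using that by (simp add: field_simps)
          then show ?thesis using s_prop[OF \<open>x \<in> X\<close>, of n] n0
            unfolding dist_commute[of _ x] by linarith
        qed
        then show "\<exists>no. \<forall>n\<ge>no. dist (e (s n x)) x < r" by blast
      qed
      then show ?thesis
        by (rule continuous_on_tendsto_compose[OF cont[OF p(2)] _ that]) (simp add: eX)
    qed
    then show "(\<lambda>n. if fst p \<in> X then f (e (s n (fst p))) (snd p) else c)
        \<longlonglongrightarrow> (case p of (x, y) \<Rightarrow> if x \<in> X then f x y else c)"
      by (auto simp: p)
  qed
qed

section \<open>Bergman-type spaces\<close>

locale bergman_space =
  fixes \<Omega> :: "(complex^'n::finite) set"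
    and \<phi> :: "complex^'n \<Rightarrow> complex^'n \<Rightarrow> complex^'n"
    and d :: "complex^'n \<Rightarrow> complex^'n \<Rightarrow> real"
    and \<sigma> :: "(complex^'n) measure"
    and K :: "complex^'n \<Rightarrow> complex^'n \<Rightarrow> complex"
    and \<kappa> :: real
  assumes bergman: "bergman_type \<Omega> \<phi> d \<sigma> K \<kappa>"
begin

abbreviation N :: "complex^'n \<Rightarrow> real" where "N z \<equiv> L2norm \<sigma> (K z)"
abbreviation k :: "complex^'n \<Rightarrow> complex^'n \<Rightarrow> complex" where "k z \<equiv> nkernel \<sigma> K z"

section \<open>The axioms as separate facts\<close>

lemma open_domain: "open \<Omega>" and zero_in_domain: "0 \<in> \<Omega>"
  using bergman unfolding bergman_type_def by (simp_all only: simp_thms)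

lemma
  assumes "z \<in> \<Omega>"
  shows phi_in_domain: "w \<in> \<Omega> \<Longrightarrow> \<phi> z w \<in> \<Omega>"
    and phi_involution: "w \<in> \<Omega> \<Longrightarrow> \<phi> z (\<phi> z w) = w"
    and phi_holo: "holo_map_on \<Omega> (\<phi> z)"
proof -
  have "\<forall>z\<in>\<Omega>. \<phi> z ` \<Omega> = \<Omega> \<and> (\<forall>w\<in>\<Omega>. \<phi> z (\<phi> z w) = w) \<and>
             holo_map_on \<Omega> (\<phi> z) \<and> \<phi> z 0 = z"
    using bergman unfolding bergman_type_def by (elim conjE)
  then show "w \<in> \<Omega> \<Longrightarrow> \<phi> z w \<in> \<Omega>" "w \<in> \<Omega> \<Longrightarrow> \<phi> z (\<phi> z w) = w" "holo_map_on \<Omega> (\<phi> z)"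
    using assms by blast+
qed

lemma sets_sigma: "sets \<sigma> = sets borel" and finite_sigma: "finite_measure \<sigma>"
  and null_sigma: "emeasure \<sigma> (UNIV - \<Omega>) = 0"
  using bergman unfolding bergman_type_def by (simp_all only: simp_thms)

lemma Bspace_complete:
  assumes "\<And>n. f n \<in> Bspace \<Omega> \<sigma>"
    and "\<And>e. e > 0 \<Longrightarrow> \<exists>N. \<forall>m\<ge>N. \<forall>n\<ge>N. L2norm \<sigma> (\<lambda>x. f m x - f n x) < e"
  obtains g where "g \<in> Bspace \<Omega> \<sigma>" "(\<lambda>n. L2norm \<sigma> (\<lambda>x. f n x - g x)) \<longlonglongrightarrow> 0"
proof -
  have "\<forall>f. (\<forall>n. f n \<in> Bspace \<Omega> \<sigma>) \<longrightarrow>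
         (\<forall>e>0. \<exists>N. \<forall>m\<ge>N. \<forall>n\<ge>N. L2norm \<sigma> (\<lambda>x. f m x - f n x) < e) \<longrightarrow>
         (\<exists>g\<in>Bspace \<Omega> \<sigma>. (\<lambda>n. L2norm \<sigma> (\<lambda>x. f n x - g x)) \<longlonglongrightarrow> 0)"
    using bergman unfolding bergman_type_def by (elim conjE)
  then show ?thesis using assms that by blast
qed

lemma K_in_Bspace:
  assumes "z \<in> \<Omega>"
  shows "K z \<in> Bspace \<Omega> \<sigma>"
proof -
  have "\<forall>z\<in>\<Omega>. K z \<in> Bspace \<Omega> \<sigma>"
    using bergman unfolding bergman_type_def by (elim conjE)
  then show ?thesis using assms by blast
qed

lemma reproducing:
  assumes "z \<in> \<Omega>" "f \<in> Bspace \<Omega> \<sigma>"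
  shows "L2inner \<sigma> f (K z) = f z"
proof -
  have "\<forall>z\<in>\<Omega>. \<forall>f\<in>Bspace \<Omega> \<sigma>. f z = L2inner \<sigma> f (K z)"
    using bergman unfolding bergman_type_def by (elim conjE)
  then show ?thesis using assms by simp
qed

lemma lam_quasi_invariant:
  obtains C where "C > 0" "\<And>z E. z \<in> \<Omega> \<Longrightarrow> E \<in> sets borel \<Longrightarrow> E \<subseteq> \<Omega> \<Longrightarrow>
        emeasure (lam \<sigma> K) E \<le> ennreal C * emeasure (lam \<sigma> K) (\<phi> z ` E)"
proof -
  have "\<exists>C>0. \<forall>z\<in>\<Omega>. \<forall>E\<in>sets borel. E \<subseteq> \<Omega> \<longrightarrow>
        emeasure (lam \<sigma> K) E \<le> ennreal C * emeasure (lam \<sigma> K) (\<phi> z ` E) \<and>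
        emeasure (lam \<sigma> K) (\<phi> z ` E) \<le> ennreal C * emeasure (lam \<sigma> K) E"
    using bergman unfolding bergman_type_def by (elim conjE)
  then show ?thesis using that by blast
qed

lemma inverse_norm_le_inner:
  obtains C where "C > 0" "\<And>z w. z \<in> \<Omega> \<Longrightarrow> w \<in> \<Omega> \<Longrightarrow>
        1 / N (\<phi> z w) \<le> C * cmod (L2inner \<sigma> (k z) (k w))"
proof -
  have "\<exists>C>0. \<forall>z\<in>\<Omega>. \<forall>w\<in>\<Omega>.
        cmod (L2inner \<sigma> (nkernel \<sigma> K z) (nkernel \<sigma> K w)) \<le> C / L2norm \<sigma> (K (\<phi> z w)) \<and>
        1 / L2norm \<sigma> (K (\<phi> z w)) \<le> C * cmod (L2inner \<sigma> (nkernel \<sigma> K z) (nkernel \<sigma> K w))"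
    using bergman unfolding bergman_type_def by (elim conjE)
  then show ?thesis using that by blast
qed

lemma kappa_bounds: "0 \<le> \<kappa>" "\<kappa> < 2"
  using bergman unfolding bergman_type_def by (simp_all only: simp_thms)

lemma Rudin_Forelli:
  assumes "if \<kappa> > 0 then r > \<kappa> \<and> \<kappa> > s \<and> s > 0 else r = s \<and> s > 0"
  obtains M where "\<And>z. z \<in> \<Omega> \<Longrightarrow>
          (\<integral>\<^sup>+ w. ennreal (cmod (L2inner \<sigma> (K z) (K w)) powr ((r + s) / 2)
                     / (N z powr s * N w powr r)) \<partial>(lam \<sigma> K)) \<le> ennreal M"
proof -
  have "\<forall>r s. (if \<kappa> > 0 then r > \<kappa> \<and> \<kappa> > s \<and> s > 0 else r = s \<and> s > 0) \<longrightarrow>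
       (\<exists>M. \<forall>z\<in>\<Omega>.
          (\<integral>\<^sup>+ w. ennreal (cmod (L2inner \<sigma> (K z) (K w)) powr ((r + s) / 2)
                     / (L2norm \<sigma> (K z) powr s * L2norm \<sigma> (K w) powr r)) \<partial>(lam \<sigma> K))
          \<le> ennreal M)"
    using bergman unfolding bergman_type_def by (elim conjE)
  then show ?thesis using assms that by blast
qed

section \<open>The carrier of the measure and the linear structure of the space\<close>

lemma measurable_sigma: "measurable \<sigma> L = measurable borel L"
  by (rule measurable_cong_sets) (simp_all add: sets_sigma)

text \<open>The measure lives on all of C^n with a null complement of the domain. Pointwise
  estimates known only on the domain enter integrals through this fact.\<close>

lemma AE_in_domain: "AE x in \<sigma>. x \<in> \<Omega>"
proof (rule AE_I)
  show "{x \<in> space \<sigma>. x \<notin> \<Omega>} \<subseteq> UNIV - \<Omega>" by auto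
  show "UNIV - \<Omega> \<in> sets \<sigma>" using open_domain by (simp add: sets_sigma)
qed (rule null_sigma)

lemma Bspace_Lsq: "f \<in> Bspace \<Omega> \<sigma> \<Longrightarrow> f \<in> Lsq \<sigma>"
  by (simp add: Bspace_def Lsq_def)

lemma Bspace_measurable: "f \<in> Bspace \<Omega> \<sigma> \<Longrightarrow> f \<in> borel_measurable borel"
  by (simp add: Bspace_def measurable_sigma)

lemma Bspace_zero: "f \<in> Bspace \<Omega> \<sigma> \<Longrightarrow> x \<notin> \<Omega> \<Longrightarrow> f x = 0"
  by (simp add: Bspace_def)

lemma holo_on_continuous: "holo_on \<Omega> f \<Longrightarrow> continuous_on \<Omega> f"
  unfolding holo_on_def
  by (meson continuous_at_imp_continuous_on has_derivative_continuous)

lemma Bspace_continuous: "f \<in> Bspace \<Omega> \<sigma> \<Longrightarrow> continuous_on \<Omega> f"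
  by (simp add: Bspace_def holo_on_continuous)

lemma Bspace_lincomb:
  assumes "f \<in> Bspace \<Omega> \<sigma>" "g \<in> Bspace \<Omega> \<sigma>"
  shows "(\<lambda>x. a * f x + b * g x) \<in> Bspace \<Omega> \<sigma>"
proof -
  have "holo_on \<Omega> (\<lambda>x. a * f x + b * g x)"
    unfolding holo_on_def
  proof
    fix x assume x: "x \<in> \<Omega>"
    obtain Lf where Lf: "(f has_derivative Lf) (at x)" "\<And>c v. Lf (c *s v) = c * Lf v"
      using assms(1) x by (auto simp: Bspace_def holo_on_def)
    obtain Lg where Lg: "(g has_derivative Lg) (at x)" "\<And>c v. Lg (c *s v) = c * Lg v"
      using assms(2) x by (auto simp: Bspace_def holo_on_def)
    show "\<exists>L. ((\<lambda>x. a * f x + b * g x) has_derivative L) (at x) \<and> (\<forall>c v. L (c *s v) = c * L v)"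
      using Lf Lg
      by (intro exI[of _ "\<lambda>v. a * Lf v + b * Lg v"] conjI has_derivative_add has_derivative_mult_right)
        (auto simp: algebra_simps)
  qed
  then show ?thesis
    using Lsq_lincomb[OF assms[THEN Bspace_Lsq], of a b] assms by (simp add: Bspace_def Lsq_def)
qed

lemma Bspace_mult: "f \<in> Bspace \<Omega> \<sigma> \<Longrightarrow> (\<lambda>x. a * f x) \<in> Bspace \<Omega> \<sigma>"
  using Bspace_lincomb[of f f a 0] by simp

lemma Bspace_diff: "f \<in> Bspace \<Omega> \<sigma> \<Longrightarrow> g \<in> Bspace \<Omega> \<sigma> \<Longrightarrow> (\<lambda>x. f x - g x) \<in> Bspace \<Omega> \<sigma>"
  using Bspace_lincomb[of f g 1 "-1"] by simp

lemma indicator_in_Bspace: "indicator \<Omega> \<in> Bspace \<Omega> \<sigma>"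
proof -
  have "holo_on \<Omega> (indicator \<Omega>)"
    unfolding holo_on_def
  proof
    fix x assume x: "x \<in> \<Omega>"
    \<comment> \<open>The domain is open, so the indicator is locally the constant 1.\<close>
    have "((\<lambda>_. 1) has_derivative (\<lambda>_. 0)) (at x)" by simp
    then have "((indicator \<Omega> :: _ \<Rightarrow> complex) has_derivative (\<lambda>_. 0)) (at x)"
      by (rule has_derivative_transform_within_open[OF _ open_domain x]) simp
    then show "\<exists>L. ((indicator \<Omega> :: _ \<Rightarrow> complex) has_derivative L) (at x) \<and> (\<forall>c v. L (c *s v) = c * L v)"
      by (intro exI[of _ "\<lambda>_. 0"]) simp
  qed
  moreover have [measurable]: "\<Omega> \<in> sets \<sigma>" using open_domain by (simp add: sets_sigma)
  moreover have "integrable \<sigma> (\<lambda>x. (cmod (indicator \<Omega> x))\<^sup>2)"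
  proof (rule finite_measure.integrable_const_bound[OF finite_sigma])
    show "AE x in \<sigma>. norm ((cmod (indicator \<Omega> x))\<^sup>2) \<le> 1"
      by (auto simp: indicator_def)
  qed measurable
  ultimately show ?thesis by (simp add: Bspace_def)
qed

text \<open>The finiteness of the measure puts the constants into the space, so no kernel vanishes.\<close>

lemma N_pos:
  assumes "z \<in> \<Omega>"
  shows "N z > 0"
proof (rule ccontr)
  assume "\<not> N z > 0"
  then have "N z = 0" using L2norm_nonneg[of \<sigma> "K z"] by linarith
  then have "L2inner \<sigma> (indicator \<Omega>) (K z) = 0"
    using L2_Cauchy_Schwarz[OF Bspace_Lsq[OF indicator_in_Bspace] Bspace_Lsq[OF K_in_Bspace[OF assms]]]
    by simp
  then show False using reproducing[OF assms indicator_in_Bspace] assms by simp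
qed

section \<open>Identities for the kernels\<close>

lemma K_inner: "z \<in> \<Omega> \<Longrightarrow> w \<in> \<Omega> \<Longrightarrow> L2inner \<sigma> (K z) (K w) = K z w"
  by (simp add: reproducing K_in_Bspace)

lemma K_commute: "z \<in> \<Omega> \<Longrightarrow> w \<in> \<Omega> \<Longrightarrow> K z w = cnj (K w z)"
  using L2inner_commute[of \<sigma> "K z" "K w"] by (simp add: K_inner)

lemma K_diag: "z \<in> \<Omega> \<Longrightarrow> K z z = complex_of_real ((N z)\<^sup>2)"
  using K_inner[of z z] by (simp only: L2inner_self)

lemma k_eq: "k z = (\<lambda>x. complex_of_real (1 / N z) * K z x)"
  by (simp add: nkernel_def)

lemma k_in_Bspace: "z \<in> \<Omega> \<Longrightarrow> k z \<in> Bspace \<Omega> \<sigma>"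
  unfolding k_eq by (intro Bspace_mult K_in_Bspace)

lemma L2norm_k: "z \<in> \<Omega> \<Longrightarrow> L2norm \<sigma> (k z) = 1"
  unfolding k_eq L2norm_mult norm_of_real using N_pos[of z] by simp

lemma inner_k:
  assumes "z \<in> \<Omega>" "f \<in> Bspace \<Omega> \<sigma>"
  shows "L2inner \<sigma> f (k z) = f z / complex_of_real (N z)"
proof -
  have "L2inner \<sigma> (k z) f = complex_of_real (1 / N z) * L2inner \<sigma> (K z) f"
    using L2inner_lincomb_left[of "K z" \<sigma> "K z" f "complex_of_real (1 / N z)" 0] assms
    by (simp add: k_eq Bspace_Lsq K_in_Bspace)
  then have "cnj (L2inner \<sigma> (k z) f) = complex_of_real (1 / N z) * cnj (L2inner \<sigma> (K z) f)" by simp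
  then show ?thesis by (simp add: L2inner_commute[symmetric] reproducing assms)
qed

text \<open>Two readings of the quantity in (A.5): the first leads to the Rudin--Forelli integrand,
  the second to the factor \<open>k z\<close> in the translation operator.\<close>

lemma cmod_k:
  assumes "z \<in> \<Omega>" "w \<in> \<Omega>"
  shows "cmod (L2inner \<sigma> (k z) (k w)) = cmod (K z w) / (N z * N w)"
    and "cmod (k z w) = N w * cmod (L2inner \<sigma> (k z) (k w))"
proof -
  have "k z w = K z w / complex_of_real (N z)" by (simp add: nkernel_def)
  then show "cmod (L2inner \<sigma> (k z) (k w)) = cmod (K z w) / (N z * N w)"
    "cmod (k z w) = N w * cmod (L2inner \<sigma> (k z) (k w))"
    using assms N_pos[of z] N_pos[of w]
    by (auto simp: inner_k k_in_Bspace norm_divide norm_mult)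
qed

text \<open>Off the domain \<open>K\<close> and \<open>\<phi>\<close> are unconstrained, possibly not even measurable; \<open>Nm\<close> and \<open>phi0\<close> are
  Borel functions agreeing with \<open>N\<close> and \<open>\<phi>\<close> on it.\<close>

definition Nm :: "complex^'n \<Rightarrow> real" where
  "Nm w = (if w \<in> \<Omega> then N w else 1)"

lemma Nm_pos: "Nm w > 0"
  by (simp add: Nm_def N_pos)

lemma Nm_eq: "w \<in> \<Omega> \<Longrightarrow> Nm w = N w"
  by (simp add: Nm_def)

text \<open>The squared norm is the diagonal value \<open>K x x\<close>, so it suffices to restrict
  a jointly measurable function to the diagonal. \<open>K x y\<close> is measurable in
  \<open>y\<close> and, by conjugate symmetry, continuous in \<open>x\<close>.\<close>

lemma Nm_measurable [measurable]: "Nm \<in> borel_measurable borel"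
proof -
  have "(\<lambda>(x, y). if x \<in> \<Omega> then K x y else 1) \<in> borel_measurable (borel \<Otimes>\<^sub>M borel)"
  proof (rule borel_measurable_pair_continuous)
    show "open \<Omega>" "\<Omega> \<noteq> {}" using open_domain zero_in_domain by auto
    show "continuous_on \<Omega> (\<lambda>x. K x y)" for y
    proof (cases "y \<in> \<Omega>")
      case True
      have "continuous_on \<Omega> (\<lambda>x. cnj (K y x))"
        by (intro continuous_on_cnj Bspace_continuous K_in_Bspace True)
      then show ?thesis
        by (rule continuous_on_eq) (rule K_commute[OF _ True, symmetric])
    next
      case False
      then show ?thesis
        using Bspace_zero[OF K_in_Bspace False] by (simp cong: continuous_on_cong)
    qed
    show "K x \<in> borel_measurable borel" if "x \<in> \<Omega>" for x
      using that by (intro Bspace_measurable K_in_Bspace)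
  qed
  from measurable_compose[OF _ this, of "\<lambda>x. (x, x)" borel]
  have [measurable]: "(\<lambda>x. if x \<in> \<Omega> then K x x else 1) \<in> borel_measurable borel"
    by simp
  have "Nm = (\<lambda>x. sqrt (Re (if x \<in> \<Omega> then K x x else 1)))"
    by (auto simp: Nm_def K_diag)
  then show ?thesis by simp
qed

text \<open>This replaces the density by a Borel function. A density measure is defined through
  integrals of arbitrary functions, so agreement almost everywhere suffices even if \<open>N\<close>
  is not measurable.\<close>

lemma lam_eq: "lam \<sigma> K = density \<sigma> (\<lambda>w. ennreal ((Nm w)\<^sup>2))"
proof -
  have "(\<integral>\<^sup>+ x. ennreal ((N x)\<^sup>2) * indicator A x \<partial>\<sigma>) = (\<integral>\<^sup>+ x. ennreal ((Nm x)\<^sup>2) * indicator A x \<partial>\<sigma>)" for A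
    by (rule nn_integral_cong_AE) (use AE_in_domain in eventually_elim, simp add: Nm_eq)
  then show ?thesis unfolding lam_def density_def by simp
qed

lemma nn_integral_lam:
  assumes [measurable]: "f \<in> borel_measurable borel"
  shows "(\<integral>\<^sup>+ w. f w \<partial>lam \<sigma> K) = (\<integral>\<^sup>+ w. ennreal ((Nm w)\<^sup>2) * f w \<partial>\<sigma>)"
  unfolding lam_eq using assms by (intro nn_integral_density) (simp_all add: measurable_sigma)

lemma AE_lam_in_domain: "AE x in lam \<sigma> K. x \<in> \<Omega>"
proof -
  have "(\<lambda>w. ennreal ((Nm w)\<^sup>2)) \<in> borel_measurable \<sigma>"
    unfolding measurable_sigma by measurable
  then show ?thesis
    unfolding lam_eq using AE_in_domain by (subst AE_density) auto
qed

lemma sets_lam: "sets (lam \<sigma> K) = sets borel"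
  by (simp add: lam_def sets_sigma)

lemma measurable_lam: "measurable (lam \<sigma> K) L = measurable borel L"
  by (rule measurable_cong_sets) (simp_all add: sets_lam)

definition phi0 :: "complex^'n \<Rightarrow> complex^'n \<Rightarrow> complex^'n" where
  "phi0 z w = (if w \<in> \<Omega> then \<phi> z w else 0)"

lemma phi0_measurable [measurable]:
  assumes "z \<in> \<Omega>"
  shows "phi0 z \<in> borel_measurable borel"
proof -
  have "continuous_on \<Omega> (\<phi> z)"
    unfolding continuous_on_def
  proof (intro ballI vec_tendstoI)
    fix x i assume "x \<in> \<Omega>"
    then show "((\<lambda>w. \<phi> z w $ i) \<longlongrightarrow> \<phi> z x $ i) (at x within \<Omega>)"
      using phi_holo[OF assms] holo_on_continuous unfolding holo_map_on_def continuous_on_def by blast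
  qed
  then show ?thesis
    unfolding phi0_def using open_domain by (intro borel_measurable_continuous_on_if) auto
qed

text \<open>A change of variables up to a constant. As \<phi> is an involution, images of sets are
  preimages, and quasi-invariance says that \<lambda> is at most a multiple of its own push-forward;
  integrating against both measures gives the claim.\<close>

lemma nn_integral_lam_phi0:
  obtains C where "C > 0"
    "\<And>z u. z \<in> \<Omega> \<Longrightarrow> u \<in> borel_measurable borel \<Longrightarrow>
      (\<integral>\<^sup>+ w. u w \<partial>lam \<sigma> K) \<le> ennreal C * (\<integral>\<^sup>+ w. u (phi0 z w) \<partial>lam \<sigma> K)"
proof -
  obtain C where C: "C > 0" "\<And>z E. z \<in> \<Omega> \<Longrightarrow> E \<in> sets borel \<Longrightarrow> E \<subseteq> \<Omega> \<Longrightarrow>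
        emeasure (lam \<sigma> K) E \<le> ennreal C * emeasure (lam \<sigma> K) (\<phi> z ` E)"
    using lam_quasi_invariant by blast
  have "(\<integral>\<^sup>+ w. u w \<partial>lam \<sigma> K) \<le> ennreal C * (\<integral>\<^sup>+ w. u (phi0 z w) \<partial>lam \<sigma> K)"
    if z: "z \<in> \<Omega>" and u: "u \<in> borel_measurable borel" for z u
  proof -
    have phi0: "phi0 z \<in> measurable (lam \<sigma> K) borel"
      unfolding measurable_lam by (rule phi0_measurable[OF z])
    let ?\<nu> = "distr (lam \<sigma> K) borel (phi0 z)"
    have le: "lam \<sigma> K \<le> scale_measure (ennreal C) ?\<nu>"
    proof (subst le_measure)
      show "\<forall>A\<in>sets (lam \<sigma> K). emeasure (lam \<sigma> K) A \<le> emeasure (scale_measure (ennreal C) ?\<nu>) A"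
      proof
        fix A assume A: "A \<in> sets (lam \<sigma> K)"
        then have A': "A \<in> sets borel" by (simp add: sets_lam)
        have A\<Omega>: "A \<inter> \<Omega> \<in> sets borel" using A' open_domain by simp
        have "emeasure (lam \<sigma> K) A = emeasure (lam \<sigma> K) (A \<inter> \<Omega>)"
          by (rule emeasure_eq_AE) (use AE_lam_in_domain A A\<Omega> in \<open>auto simp: sets_lam\<close>)
        also have "\<dots> \<le> ennreal C * emeasure (lam \<sigma> K) (\<phi> z ` (A \<inter> \<Omega>))"
          by (rule C(2)[OF z A\<Omega>]) simp
        \<comment> \<open>Only an inclusion of sets: \<open>phi0 z\<close> sends the complement of
          the domain to 0, which may belong to \<open>A\<close>.\<close>
        also have "\<dots> \<le> ennreal C * emeasure (lam \<sigma> K) (phi0 z -` A \<inter> space (lam \<sigma> K))"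
        proof (intro mult_left_mono emeasure_mono)
          show "\<phi> z ` (A \<inter> \<Omega>) \<subseteq> phi0 z -` A \<inter> space (lam \<sigma> K)"
            using sets_eq_imp_space_eq[OF sets_lam]
            by (auto simp: phi0_def phi_in_domain[OF z] phi_involution[OF z])
          show "phi0 z -` A \<inter> space (lam \<sigma> K) \<in> sets (lam \<sigma> K)"
            using phi0 A' by (rule measurable_sets)
        qed simp
        finally show "emeasure (lam \<sigma> K) A \<le> emeasure (scale_measure (ennreal C) ?\<nu>) A"
          using A' by (simp add: emeasure_distr[OF phi0])
      qed
    qed (simp add: sets_lam)
    have "(\<integral>\<^sup>+ w. u w \<partial>lam \<sigma> K) \<le> (\<integral>\<^sup>+ w. u w \<partial>scale_measure (ennreal C) ?\<nu>)"
      by (rule nn_integral_mono_measure[OF _ le]) (simp add: sets_lam)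
    also have "\<dots> = ennreal C * (\<integral>\<^sup>+ w. u (phi0 z w) \<partial>lam \<sigma> K)"
      using u by (simp add: nn_integral_scale_measure nn_integral_distr[OF phi0])
    finally show ?thesis .
  qed
  then show ?thesis using that C(1) by blast
qed

end

section \<open>The Schur estimates\<close>

text \<open>With \<open>e = q - 1\<close>, the exponents are r = 2 - a and s = a - 2 e. For positive
  \<kappa> the conditions read 2 e < a, a < 2 - \<kappa> and a < \<kappa> + 2 e, so they are
  solvable when 2 e < 2 - \<kappa>. This is the lower bound on \<open>p\<close>, rewritten.\<close>

lemma Rudin_Forelli_exponent:
  fixes \<kappa> p q :: real
  assumes "0 \<le> \<kappa>" "\<kappa> < 2" and p: "p > (4 - \<kappa>) / (2 - \<kappa>)" and q: "q = p / (p - 1)"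
  obtains a where "p > 2" "1 < q" "q < 2" "1 / p + 1 / q = 1"
    "if \<kappa> > 0 then 2 - a > \<kappa> \<and> \<kappa> > 2 - 2 * q + a \<and> 2 - 2 * q + a > 0
     else 2 - a = 2 - 2 * q + a \<and> 2 - 2 * q + a > 0"
proof -
  have "2 \<le> (4 - \<kappa>) / (2 - \<kappa>)" using assms(1,2) by (simp add: field_simps)
  then have p2: "p > 2" using p by linarith
  define e where "e = 1 / (p - 1)"
  have qe: "q = 1 + e" using p2 by (simp add: q e_def field_simps)
  have e: "0 < e" "e < 1" using p2 by (auto simp: e_def field_simps)
  have "4 - \<kappa> < p * (2 - \<kappa>)" using p assms(2) by (simp add: divide_less_eq)
  then have "2 < (2 - \<kappa>) * (p - 1)" by (simp add: algebra_simps)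
  then have e2: "2 * e < 2 - \<kappa>" using p2 by (simp add: e_def divide_less_eq)
  have conj: "1 / p + 1 / q = 1" using p2 by (simp add: q field_simps)
  show ?thesis
  proof (cases "\<kappa> > 0")
    case True
    \<comment> \<open>The midpoint of the open interval of admissible values.\<close>
    define a where "a = (2 * e + min (2 - \<kappa>) (\<kappa> + 2 * e)) / 2"
    show ?thesis
      by (rule that[of a]) (use p2 qe e e2 conj True in \<open>auto simp: a_def min_def field_simps\<close>)
  next
    case False
    \<comment> \<open>Equality of r and s forces \<open>a = q\<close>; then s = 1 - e is
      positive.\<close>
    show ?thesis
      by (rule that[of q]) (use p2 qe e e2 conj False in auto)
  qed
qed

text \<open>Here \<open>m\<close>, \<open>n\<close>, \<open>P\<close> stand for the kernel norms at
  z, w and \<phi> z w, and \<open>n^2\<close> is the density of \<lambda>. Young's inequality under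
  the integral takes the place of Hoelder's: a sum of two bounded integrals is as good as their
  product.\<close>

lemma Young_weighted:
  fixes m n P g p q \<alpha> :: real
  assumes pos: "m > 0" "n > 0" "P > 0" "g \<ge> 0" and "p > 1" "q > 1" and conj: "1 / p + 1 / q = 1"
  shows "m * g * n powr \<alpha> \<le> m powr \<alpha> * (n\<^sup>2 * (g powr p * n powr (- p) * P powr (p - 2)
      + m powr (q - q * \<alpha>) * n powr (q * \<alpha> - q) * P powr (q - 2)))"
proof -
  \<comment> \<open>The powers of \<open>P\<close> cancel in \<open>A * B\<close>. Their exponents
    become \<open>p - 2\<close> in the p-th power of \<open>A\<close> and \<open>q - 2\<close> in
    the q-th power of \<open>B\<close>, as the two integral estimates require.\<close>
  define A where "A = g * n powr (- 1) * P powr (1 - 2 / p)"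
  define B where "B = m powr (1 - \<alpha>) * n powr (\<alpha> - 1) * P powr (2 / p - 1)"
  have AB0: "0 \<le> A" "0 \<le> B" using pos by (auto simp: A_def B_def)
  have "P powr (1 - 2 / p) * P powr (2 / p - 1) = 1"
    using pos by (simp add: powr_add[symmetric])
  moreover have "n powr (-1) * n powr (\<alpha> - 1) * n\<^sup>2 = n powr \<alpha>"
  proof -
    have "n\<^sup>2 = n powr 2" using pos by simp
    then show ?thesis by (simp only: powr_add[symmetric]) simp
  qed
  moreover have "m powr \<alpha> * m powr (1 - \<alpha>) = m"
    using pos by (simp add: powr_add[symmetric])
  moreover have "m powr \<alpha> * (n\<^sup>2 * (A * B)) = (m powr \<alpha> * m powr (1 - \<alpha>)) * g
      * (n powr (-1) * n powr (\<alpha> - 1) * n\<^sup>2) * (P powr (1 - 2 / p) * P powr (2 / p - 1))"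
    by (simp add: A_def B_def algebra_simps)
  ultimately have eq: "m * g * n powr \<alpha> = m powr \<alpha> * (n\<^sup>2 * (A * B))" by simp
  have q: "q * (2 / p - 1) = q - 2"
  proof -
    have "1 / p = 1 - 1 / q" using conj by linarith
    then have "2 / p = 2 - 2 / q" by (simp add: field_simps)
    then show ?thesis using \<open>q > 1\<close> by (simp add: field_simps)
  qed
  have Ap: "A powr p = g powr p * n powr (- p) * P powr (p - 2)"
  proof -
    have "(1 - 2 / p) * p = p - 2" using \<open>p > 1\<close> by (simp add: field_simps)
    moreover have "A powr p = g powr p * n powr (- 1 * p) * P powr ((1 - 2 / p) * p)"
      unfolding A_def using pos by (simp only: powr_mult powr_powr)
    ultimately show ?thesis by simp
  qed
  have "B powr q = m powr ((1 - \<alpha>) * q) * n powr ((\<alpha> - 1) * q) * P powr (q * (2 / p - 1))"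
    using pos by (simp add: B_def powr_mult powr_powr mult.commute)
  then have Bq: "B powr q = m powr (q - q * \<alpha>) * n powr (q * \<alpha> - q) * P powr (q - 2)"
    unfolding q by (simp add: algebra_simps)
  have "A * B \<le> A powr p / p + B powr q / q"
    using Youngs_inequality[OF \<open>p > 1\<close> \<open>q > 1\<close> conj AB0] .
  also have "\<dots> \<le> A powr p + B powr q"
    using \<open>p > 1\<close> \<open>q > 1\<close> by (intro add_mono) (simp_all add: divide_le_eq mult_le_cancel_left1)
  finally have "A * B \<le> A powr p + B powr q" .
  then have "m powr \<alpha> * (n\<^sup>2 * (A * B)) \<le> m powr \<alpha> * (n\<^sup>2 * (A powr p + B powr q))"
    by (intro mult_left_mono) auto
  then show ?thesis unfolding eq Ap Bq .
qed

text \<open>The exponent \<open>q - 2\<close> is negative, so the bound on \<open>1 / P\<close> from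
  (A.5) applies. The result is the Rudin--Forelli integrand with r = 2 - a and s = 2 - 2 q + a, for
  which (r + s) / 2 = 2 - q.\<close>

lemma powr_weight_le:
  fixes m n P x C q a :: real
  assumes pos: "m > 0" "n > 0" "P > 0" "x \<ge> 0" "C > 0" and "q < 2" and le: "1 / P \<le> C * (x / (m * n))"
  shows "m powr (q - a) * n powr (a - q) * P powr (q - 2)
    \<le> C powr (2 - q) * (x powr (2 - q) / (m powr (2 - 2 * q + a) * n powr (2 - a)))"
proof -
  have "P powr (q - 2) = (1 / P) powr (2 - q)"
    using pos by (simp add: powr_divide powr_minus_divide[symmetric])
  also have "\<dots> \<le> (C * (x / (m * n))) powr (2 - q)"
    using le pos \<open>q < 2\<close> by (intro powr_mono2) auto
  also have "\<dots> = C powr (2 - q) * (x powr (2 - q) * (m powr (q - 2) * n powr (q - 2)))"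
    using pos powr_minus_divide[of m "2 - q"] powr_minus_divide[of n "2 - q"]
    by (simp add: powr_mult powr_divide)
  finally have "m powr (q - a) * n powr (a - q) * P powr (q - 2)
    \<le> m powr (q - a) * n powr (a - q) * (C powr (2 - q) * (x powr (2 - q) * (m powr (q - 2) * n powr (q - 2))))"
    by (intro mult_left_mono) auto
  also have "\<dots> = C powr (2 - q) * (x powr (2 - q) * ((m powr (q - a) * m powr (q - 2)) * (n powr (a - q) * n powr (q - 2))))"
    by (simp add: algebra_simps)
  also have "m powr (q - a) * m powr (q - 2) = m powr (- (2 - 2 * q + a))"
    by (simp add: powr_add[symmetric] algebra_simps)
  also have "n powr (a - q) * n powr (q - 2) = n powr (- (2 - a))"
    by (simp add: powr_add[symmetric])
  finally show ?thesis by (simp only: powr_minus_divide) simp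
qed

context bergman_space
begin

text \<open>To be used with \<open>G z\<close> equal to \<open>T (k z)\<close> and to
  \<open>Tstar (k z)\<close>, where \<open>N z * G z w\<close> is the operator applied to
  \<open>K z\<close>, evaluated at w. Young's inequality splits the integrand; one half is
  controlled by \<open>sup\<close>, the other by Rudin--Forelli.\<close>

lemma Schur_estimate:
  fixes G :: "complex^'n \<Rightarrow> complex^'n \<Rightarrow> complex"
  assumes pq: "p > 2" "1 < q" "q < 2" "1 / p + 1 / q = 1"
    and exponent: "if \<kappa> > 0 then 2 - a > \<kappa> \<and> \<kappa> > 2 - 2 * q + a \<and> 2 - 2 * q + a > 0
     else 2 - a = 2 - 2 * q + a \<and> 2 - 2 * q + a > 0"
    and G: "\<And>z. z \<in> \<Omega> \<Longrightarrow> G z \<in> Bspace \<Omega> \<sigma>"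
    and sup: "(SUP z\<in>\<Omega>. \<integral>\<^sup>+ w. ennreal (cmod (transl \<sigma> K \<phi> z (G z) w) powr p) \<partial>\<sigma>) < \<infinity>"
  obtains C where "C > 0" "\<And>z. z \<in> \<Omega> \<Longrightarrow>
    (\<integral>\<^sup>+ w. ennreal (N z * cmod (G z w) * Nm w powr (a / q)) \<partial>\<sigma>) \<le> ennreal (C * Nm z powr (a / q))"
proof -
  define \<alpha> where "\<alpha> = a / q"
  have a: "q * \<alpha> = a" using pq by (simp add: \<alpha>_def)
  define M where "M = (SUP z\<in>\<Omega>. \<integral>\<^sup>+ w. ennreal (cmod (transl \<sigma> K \<phi> z (G z) w) powr p) \<partial>\<sigma>)"
  obtain C1 where C1: "C1 > 0" "\<And>z u. z \<in> \<Omega> \<Longrightarrow> u \<in> borel_measurable borel \<Longrightarrow>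
      (\<integral>\<^sup>+ w. u w \<partial>lam \<sigma> K) \<le> ennreal C1 * (\<integral>\<^sup>+ w. u (phi0 z w) \<partial>lam \<sigma> K)"
    by (rule nn_integral_lam_phi0) blast
  obtain C2 where C2: "C2 > 0" "\<And>z w. z \<in> \<Omega> \<Longrightarrow> w \<in> \<Omega> \<Longrightarrow>
        1 / N (\<phi> z w) \<le> C2 * cmod (L2inner \<sigma> (k z) (k w))"
    by (rule inverse_norm_le_inner) blast
  obtain M' where M': "\<And>z. z \<in> \<Omega> \<Longrightarrow>
          (\<integral>\<^sup>+ w. ennreal (cmod (L2inner \<sigma> (K z) (K w)) powr ((2 - a + (2 - 2 * q + a)) / 2)
                     / (N z powr (2 - 2 * q + a) * N w powr (2 - a))) \<partial>(lam \<sigma> K)) \<le> ennreal M'"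
    using Rudin_Forelli[OF exponent] by blast
  define D where "D = ennreal C1 * (ennreal (C2 powr p) * M) + ennreal (C2 powr (2 - q)) * ennreal M'"
  have "D < \<infinity>"
    using sup by (auto simp: D_def M_def[symmetric] ennreal_mult_less_top)
  have main: "(\<integral>\<^sup>+ w. ennreal (N z * cmod (G z w) * Nm w powr \<alpha>) \<partial>\<sigma>) \<le> ennreal (Nm z powr \<alpha>) * D"
    if z: "z \<in> \<Omega>" for z
  proof -
    have [measurable]: "G z \<in> borel_measurable borel" "k z \<in> borel_measurable borel"
        "K z \<in> borel_measurable borel"
      using z by (auto intro!: Bspace_measurable G k_in_Bspace K_in_Bspace)
    note [measurable] = phi0_measurable[OF z]
    define u where "u = (\<lambda>w. ennreal (cmod (G z w) powr p * Nm w powr (- p) * Nm (phi0 z w) powr (p - 2)))"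
    define v where "v = (\<lambda>w. ennreal (Nm z powr (q - a) * Nm w powr (a - q) * Nm (phi0 z w) powr (q - 2)))"
    \<comment> \<open>The Rudin--Forelli integrand, written with \<open>Nm\<close> and with kernel
      values in place of inner products to make it Borel.\<close>
    define v' where "v' = (\<lambda>w. ennreal (cmod (K z w) powr (2 - q) / (N z powr (2 - 2 * q + a) * Nm w powr (2 - a))))"
    have [measurable]: "u \<in> borel_measurable borel" "v \<in> borel_measurable borel" "v' \<in> borel_measurable borel"
      unfolding u_def v_def v'_def by measurable
    \<comment> \<open>Off the domain both sides vanish together with \<open>k z\<close>, whatever
      \<phi> does there; this makes the translate measurable.\<close>
    have transl_eq: "transl \<sigma> K \<phi> z (G z) = (\<lambda>w. G z (phi0 z w) * k z w)"
    proof
      fix w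
      show "transl \<sigma> K \<phi> z (G z) w = G z (phi0 z w) * k z w"
        using Bspace_zero[OF k_in_Bspace[OF z], of w] by (simp add: transl_def phi0_def)
    qed
    have transl_meas [measurable]: "transl \<sigma> K \<phi> z (G z) \<in> borel_measurable borel"
      unfolding transl_eq by measurable

    \<comment> \<open>After the substitution, \<open>Nm (phi0 z w)\<close> becomes
      \<open>N w\<close>, and all norms combine to the p-th power of
      \<open>N w / N (\<phi> z w)\<close>. By (A.5) this quotient is at most a constant times the
      modulus of \<open>k z w\<close>, the factor missing from the translate of
      \<open>G z\<close>.\<close>
    have int_u: "(\<integral>\<^sup>+ w. u w \<partial>lam \<sigma> K) \<le> ennreal C1 * (ennreal (C2 powr p) * M)"
    proof -
      have "(\<integral>\<^sup>+ w. u w \<partial>lam \<sigma> K) \<le> ennreal C1 * (\<integral>\<^sup>+ w. u (phi0 z w) \<partial>lam \<sigma> K)"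
        by (rule C1(2)[OF z]) measurable
      also have "(\<integral>\<^sup>+ w. u (phi0 z w) \<partial>lam \<sigma> K) = (\<integral>\<^sup>+ w. ennreal ((Nm w)\<^sup>2) * u (phi0 z w) \<partial>\<sigma>)"
        by (rule nn_integral_lam) measurable
      also have "\<dots> \<le> (\<integral>\<^sup>+ w. ennreal (C2 powr p) * ennreal (cmod (transl \<sigma> K \<phi> z (G z) w) powr p) \<partial>\<sigma>)"
      proof (rule nn_integral_mono_AE, use AE_in_domain in eventually_elim)
        fix w assume w: "w \<in> \<Omega>"
        let ?v = "\<phi> z w"
        have v: "?v \<in> \<Omega>" and vv: "phi0 z ?v = w" "phi0 z w = ?v"
          using w z by (auto simp: phi0_def phi_in_domain phi_involution)
        have n: "N w > 0" "N ?v > 0" using N_pos w v by auto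
        have "N w / N ?v \<le> C2 * cmod (k z w)"
        proof -
          have "N w * (1 / N ?v) \<le> N w * (C2 * cmod (L2inner \<sigma> (k z) (k w)))"
            using C2(2)[OF z w] n by (intro mult_left_mono) auto
          then show ?thesis by (simp add: cmod_k(2)[OF z w] algebra_simps)
        qed
        then have "(N w / N ?v) powr p \<le> (C2 * cmod (k z w)) powr p"
          using n pq by (intro powr_mono2) auto
        moreover have "(N w)\<^sup>2 * (N ?v powr (- p) * N w powr (p - 2)) = (N w / N ?v) powr p"
        proof -
          have "(N w)\<^sup>2 * N w powr (p - 2) = N w powr p"
          proof -
            have "(N w)\<^sup>2 = N w powr 2" using n by simp
            then show ?thesis by (simp only: powr_add[symmetric]) simp
          qed
          then show ?thesis using n by (simp add: powr_divide powr_minus_divide)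
        qed
        ultimately have le: "(N w)\<^sup>2 * (N ?v powr (- p) * N w powr (p - 2)) \<le> C2 powr p * cmod (k z w) powr p"
          using C2(1) by (simp add: powr_mult)
        have "(N w)\<^sup>2 * (cmod (G z ?v) powr p * N ?v powr (- p) * N w powr (p - 2))
          = cmod (G z ?v) powr p * ((N w)\<^sup>2 * (N ?v powr (- p) * N w powr (p - 2)))"
          by (simp add: algebra_simps)
        also have "\<dots> \<le> cmod (G z ?v) powr p * (C2 powr p * cmod (k z w) powr p)"
          by (intro mult_left_mono le) auto
        also have "\<dots> = C2 powr p * (cmod (transl \<sigma> K \<phi> z (G z) w) powr p)"
          by (simp add: transl_def norm_mult powr_mult)
        finally show "ennreal ((Nm w)\<^sup>2) * u (phi0 z w)
          \<le> ennreal (C2 powr p) * ennreal (cmod (transl \<sigma> K \<phi> z (G z) w) powr p)"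
          unfolding u_def vv using w v by (simp add: Nm_eq ennreal_mult[symmetric] ennreal_leI)
      qed
      also have "\<dots> = ennreal (C2 powr p) * (\<integral>\<^sup>+ w. ennreal (cmod (transl \<sigma> K \<phi> z (G z) w) powr p) \<partial>\<sigma>)"
        by (rule nn_integral_cmult) (unfold measurable_sigma, measurable)
      also have "\<dots> \<le> ennreal (C2 powr p) * M"
        unfolding M_def using z by (intro mult_left_mono SUP_upper) auto
      finally show ?thesis by (simp add: mult_left_mono)
    qed

    have int_v: "(\<integral>\<^sup>+ w. v w \<partial>lam \<sigma> K) \<le> ennreal (C2 powr (2 - q)) * ennreal M'"
    proof -
      have "(\<integral>\<^sup>+ w. v w \<partial>lam \<sigma> K) \<le> (\<integral>\<^sup>+ w. ennreal (C2 powr (2 - q)) * v' w \<partial>lam \<sigma> K)"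
      proof (rule nn_integral_mono_AE, use AE_lam_in_domain in eventually_elim)
        fix w assume w: "w \<in> \<Omega>"
        have v: "\<phi> z w \<in> \<Omega>" using w z by (simp add: phi_in_domain)
        have "N z powr (q - a) * N w powr (a - q) * N (\<phi> z w) powr (q - 2)
          \<le> C2 powr (2 - q) * (cmod (K z w) powr (2 - q) / (N z powr (2 - 2 * q + a) * N w powr (2 - a)))"
          using C2 pq N_pos w z v by (intro powr_weight_le) (auto simp: cmod_k(1)[symmetric])
        then show "v w \<le> ennreal (C2 powr (2 - q)) * v' w"
          unfolding v_def v'_def using w z v
          by (simp add: Nm_eq phi0_def ennreal_mult[symmetric] ennreal_leI)
      qed
      also have "\<dots> = ennreal (C2 powr (2 - q)) * (\<integral>\<^sup>+ w. v' w \<partial>lam \<sigma> K)"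
        by (rule nn_integral_cmult) (unfold measurable_lam, measurable)
      also have "(\<integral>\<^sup>+ w. v' w \<partial>lam \<sigma> K) = (\<integral>\<^sup>+ w. ennreal (cmod (L2inner \<sigma> (K z) (K w)) powr ((2 - a + (2 - 2 * q + a)) / 2)
                     / (N z powr (2 - 2 * q + a) * N w powr (2 - a))) \<partial>(lam \<sigma> K))"
      proof (rule nn_integral_cong_AE, use AE_lam_in_domain in eventually_elim)
        fix w assume w: "w \<in> \<Omega>"
        have exp_eq: "(2 - a + (2 - 2 * q + a)) / 2 = 2 - q" by (simp add: field_simps)
        show "v' w = ennreal (cmod (L2inner \<sigma> (K z) (K w)) powr ((2 - a + (2 - 2 * q + a)) / 2)
                     / (N z powr (2 - 2 * q + a) * N w powr (2 - a)))"
          unfolding v'_def exp_eq using w z by (simp add: K_inner Nm_eq)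
      qed
      also have "\<dots> \<le> ennreal M'" by (rule M'[OF z])
      finally show ?thesis by (simp add: mult_left_mono)
    qed

    \<comment> \<open>The factor \<open>(Nm w)^2\<close> left by Young's inequality turns the
      integral over \<sigma> into one over \<lambda>.\<close>
    have "(\<integral>\<^sup>+ w. ennreal (N z * cmod (G z w) * Nm w powr \<alpha>) \<partial>\<sigma>)
      \<le> (\<integral>\<^sup>+ w. ennreal (Nm z powr \<alpha>) * (ennreal ((Nm w)\<^sup>2) * (u w + v w)) \<partial>\<sigma>)"
    proof (rule nn_integral_mono)
      fix w
      have "Nm z * cmod (G z w) * Nm w powr \<alpha> \<le> Nm z powr \<alpha> * ((Nm w)\<^sup>2 *
          (cmod (G z w) powr p * Nm w powr (- p) * Nm (phi0 z w) powr (p - 2)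
          + Nm z powr (q - q * \<alpha>) * Nm w powr (q * \<alpha> - q) * Nm (phi0 z w) powr (q - 2)))"
        by (rule Young_weighted) (use pq Nm_pos in auto)
      then show "ennreal (N z * cmod (G z w) * Nm w powr \<alpha>)
          \<le> ennreal (Nm z powr \<alpha>) * (ennreal ((Nm w)\<^sup>2) * (u w + v w))"
        unfolding u_def v_def a using z
        by (simp add: Nm_eq[OF z] ennreal_mult[symmetric] ennreal_plus[symmetric] ennreal_leI del: ennreal_plus)
    qed
    also have "\<dots> = ennreal (Nm z powr \<alpha>) * (\<integral>\<^sup>+ w. ennreal ((Nm w)\<^sup>2) * (u w + v w) \<partial>\<sigma>)"
      by (rule nn_integral_cmult) (unfold measurable_sigma, measurable)
    also have "(\<integral>\<^sup>+ w. ennreal ((Nm w)\<^sup>2) * (u w + v w) \<partial>\<sigma>) = (\<integral>\<^sup>+ w. u w + v w \<partial>lam \<sigma> K)"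
      by (rule nn_integral_lam[symmetric]) measurable
    also have "\<dots> = (\<integral>\<^sup>+ w. u w \<partial>lam \<sigma> K) + (\<integral>\<^sup>+ w. v w \<partial>lam \<sigma> K)"
      by (rule nn_integral_add) (unfold measurable_lam, measurable)
    also have "\<dots> \<le> D" unfolding D_def by (intro add_mono int_u int_v)
    finally show ?thesis by (simp add: mult_left_mono)
  qed
  \<comment> \<open>\<open>D\<close> is finite, hence has a real value; adding 1 makes the constant
    positive.\<close>
  show ?thesis
  proof (rule that[of "enn2real D + 1"])
    show "enn2real D + 1 > 0" by (simp add: add_nonneg_pos)
    fix z assume z: "z \<in> \<Omega>"
    have "D \<le> ennreal (enn2real D + 1)"
      using \<open>D < \<infinity>\<close> by (cases D) (auto intro: ennreal_leI)
    then have "ennreal (Nm z powr \<alpha>) * D \<le> ennreal ((enn2real D + 1) * Nm z powr \<alpha>)"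
      by (subst mult.commute[of "enn2real D + 1"]) (simp add: ennreal_mult mult_left_mono)
    with main[OF z]
    show "(\<integral>\<^sup>+ w. ennreal (N z * cmod (G z w) * Nm w powr (a / q)) \<partial>\<sigma>)
        \<le> ennreal ((enn2real D + 1) * Nm z powr (a / q))"
      unfolding \<alpha>_def by (rule order_trans)
  qed
qed

end

section \<open>Schur's test and density of the kernels\<close>

text \<open>The arithmetic-geometric mean inequality splits the double integral into a column part
  in \<open>f\<close> and a row part in \<open>g\<close>. The row part is half of the squared norm
  of \<open>g\<close> and is absorbed into the left side.\<close>

lemma Schur_test:
  fixes F :: "'a \<Rightarrow> 'a \<Rightarrow> real" and h :: "'a \<Rightarrow> real"
  assumes "sigma_finite_measure M"
    and F [measurable]: "(\<lambda>(x, y). F x y) \<in> borel_measurable (M \<Otimes>\<^sub>M M)" and F0: "\<And>x y. F x y \<ge> 0"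
    and h [measurable]: "h \<in> borel_measurable M" and h0: "\<And>x. h x > 0" and "C > 0"
    and row: "AE x in M. (\<integral>\<^sup>+ y. ennreal (F x y * h y) \<partial>M) \<le> ennreal (C * h x)"
    and col: "AE y in M. (\<integral>\<^sup>+ x. ennreal (F x y * h x) \<partial>M) \<le> ennreal (C * h y)"
    and f: "f \<in> Lsq M" and g: "g \<in> Lsq M"
    and g_le: "AE x in M. ennreal (cmod (g x)) \<le> (\<integral>\<^sup>+ y. ennreal (F x y * cmod (f y)) \<partial>M)"
  shows "L2norm M g \<le> C * L2norm M f"
proof -
  interpret M: sigma_finite_measure M by fact
  interpret P: pair_sigma_finite M M ..
  have [measurable]: "f \<in> borel_measurable M" "g \<in> borel_measurable M"
    using f g by (auto intro: Lsq_measurable)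
  \<comment> \<open>\<open>A\<close> is arranged for integration in \<open>x\<close> by the column
    bound, \<open>B\<close> for integration in \<open>y\<close> by the row bound.\<close>
  define A where "A = (\<lambda>x y. ennreal (C / 2 * (cmod (f y))\<^sup>2 / h y) * ennreal (F x y * h x))"
  define B where "B = (\<lambda>x y. ennreal ((cmod (g x))\<^sup>2 / (2 * C * h x)) * ennreal (F x y * h y))"
  have A_meas [measurable]: "(\<lambda>(x, y). A x y) \<in> borel_measurable (M \<Otimes>\<^sub>M M)"
    and B_meas [measurable]: "(\<lambda>(x, y). B x y) \<in> borel_measurable (M \<Otimes>\<^sub>M M)"
    unfolding A_def B_def by measurable
  have AM_GM: "ennreal (cmod (g x)) * ennreal (F x y * cmod (f y)) \<le> A x y + B x y" for x y
  proof -
    have "cmod (g x) * cmod (f y) \<le> C / 2 * (cmod (f y))\<^sup>2 / h y * h x + (cmod (g x))\<^sup>2 / (2 * C * h x) * h y"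
    proof -
      \<comment> \<open>This ratio makes the \<open>g\<close> part integrate to exactly 1/2 of the
        squared modulus of \<open>g\<close>.\<close>
      define t where "t = C * h x / h y"
      have t: "t > 0" using h0 \<open>C > 0\<close> by (simp add: t_def)
      have "0 \<le> (t * cmod (f y) - cmod (g x))\<^sup>2 / (2 * t)" using t by simp
      also have "\<dots> = t / 2 * (cmod (f y))\<^sup>2 + (cmod (g x))\<^sup>2 / (2 * t) - cmod (g x) * cmod (f y)"
        using t by (simp add: power2_eq_square field_simps)
      finally show ?thesis
        using h0[of x] h0[of y] \<open>C > 0\<close> by (simp add: t_def field_simps)
    qed
    then have "F x y * (cmod (g x) * cmod (f y))
      \<le> F x y * (C / 2 * (cmod (f y))\<^sup>2 / h y * h x + (cmod (g x))\<^sup>2 / (2 * C * h x) * h y)"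
      by (rule mult_left_mono) (rule F0)
    then show ?thesis
      unfolding A_def B_def using F0[of x y] h0[of x] h0[of y] \<open>C > 0\<close>
      by (simp add: ennreal_mult[symmetric] ennreal_plus[symmetric] ennreal_leI algebra_simps del: ennreal_plus)
  qed
  have "ennreal ((L2norm M g)\<^sup>2) = (\<integral>\<^sup>+x. ennreal (cmod (g x)) * ennreal (cmod (g x)) \<partial>M)"
    unfolding nn_integral_L2norm[OF g, symmetric] by (simp add: ennreal_mult[symmetric] power2_eq_square)
  also have "\<dots> \<le> (\<integral>\<^sup>+x. (\<integral>\<^sup>+y. A x y + B x y \<partial>M) \<partial>M)"
  proof (rule nn_integral_mono_AE, use g_le AE_space in eventually_elim)
    fix x assume le: "ennreal (cmod (g x)) \<le> (\<integral>\<^sup>+ y. ennreal (F x y * cmod (f y)) \<partial>M)" and [simp]: "x \<in> space M"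
    have "ennreal (cmod (g x)) * ennreal (cmod (g x))
        \<le> ennreal (cmod (g x)) * (\<integral>\<^sup>+ y. ennreal (F x y * cmod (f y)) \<partial>M)"
      by (intro mult_left_mono le) simp
    also have "\<dots> = (\<integral>\<^sup>+ y. ennreal (cmod (g x)) * ennreal (F x y * cmod (f y)) \<partial>M)"
      by (rule nn_integral_cmult[symmetric]) measurable
    also have "\<dots> \<le> (\<integral>\<^sup>+y. A x y + B x y \<partial>M)"
      by (intro nn_integral_mono AM_GM)
    finally show "ennreal (cmod (g x)) * ennreal (cmod (g x)) \<le> (\<integral>\<^sup>+y. A x y + B x y \<partial>M)" .
  qed
  also have "\<dots> = (\<integral>\<^sup>+x. (\<integral>\<^sup>+y. A x y \<partial>M) + (\<integral>\<^sup>+y. B x y \<partial>M) \<partial>M)"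
    by (intro nn_integral_cong nn_integral_add) measurable
  also have "\<dots> = (\<integral>\<^sup>+x. \<integral>\<^sup>+y. A x y \<partial>M \<partial>M) + (\<integral>\<^sup>+x. \<integral>\<^sup>+y. B x y \<partial>M \<partial>M)"
    by (intro nn_integral_add) measurable
  \<comment> \<open>The order is exchanged for \<open>A\<close> because the column bound needs the
    inner integral to run over \<open>x\<close>.\<close>
  also have "(\<integral>\<^sup>+x. \<integral>\<^sup>+y. A x y \<partial>M \<partial>M) = (\<integral>\<^sup>+y. \<integral>\<^sup>+x. A x y \<partial>M \<partial>M)"
    by (rule P.Fubini'[symmetric]) measurable
  also have "\<dots> \<le> (\<integral>\<^sup>+y. ennreal (C\<^sup>2 / 2) * ennreal ((cmod (f y))\<^sup>2) \<partial>M)"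
  proof (rule nn_integral_mono_AE, use col AE_space in eventually_elim)
    fix y assume le: "(\<integral>\<^sup>+ x. ennreal (F x y * h x) \<partial>M) \<le> ennreal (C * h y)" and [simp]: "y \<in> space M"
    have "(\<integral>\<^sup>+x. A x y \<partial>M) = ennreal (C / 2 * (cmod (f y))\<^sup>2 / h y) * (\<integral>\<^sup>+ x. ennreal (F x y * h x) \<partial>M)"
      unfolding A_def by (rule nn_integral_cmult) measurable
    also have "\<dots> \<le> ennreal (C / 2 * (cmod (f y))\<^sup>2 / h y) * ennreal (C * h y)"
      by (intro mult_left_mono le) simp
    also have "\<dots> = ennreal (C\<^sup>2 / 2) * ennreal ((cmod (f y))\<^sup>2)"
      using h0[of y] \<open>C > 0\<close> by (simp add: ennreal_mult[symmetric] power2_eq_square)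
    finally show "(\<integral>\<^sup>+x. A x y \<partial>M) \<le> ennreal (C\<^sup>2 / 2) * ennreal ((cmod (f y))\<^sup>2)" .
  qed
  also have "\<dots> = ennreal (C\<^sup>2 / 2 * (L2norm M f)\<^sup>2)"
    by (subst nn_integral_cmult) (auto simp: nn_integral_L2norm[OF f] ennreal_mult[symmetric])
  also have "(\<integral>\<^sup>+x. \<integral>\<^sup>+y. B x y \<partial>M \<partial>M) \<le> (\<integral>\<^sup>+x. ennreal (1 / 2) * ennreal ((cmod (g x))\<^sup>2) \<partial>M)"
  proof (rule nn_integral_mono_AE, use row AE_space in eventually_elim)
    fix x assume le: "(\<integral>\<^sup>+ y. ennreal (F x y * h y) \<partial>M) \<le> ennreal (C * h x)" and [simp]: "x \<in> space M"
    have "(\<integral>\<^sup>+y. B x y \<partial>M) = ennreal ((cmod (g x))\<^sup>2 / (2 * C * h x)) * (\<integral>\<^sup>+ y. ennreal (F x y * h y) \<partial>M)"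
      unfolding B_def by (rule nn_integral_cmult) measurable
    also have "\<dots> \<le> ennreal ((cmod (g x))\<^sup>2 / (2 * C * h x)) * ennreal (C * h x)"
      by (intro mult_left_mono le) simp
    also have "\<dots> = ennreal (1 / 2) * ennreal ((cmod (g x))\<^sup>2)"
      using h0[of x] \<open>C > 0\<close> by (simp add: ennreal_mult[symmetric] del: ennreal_half)
    finally show "(\<integral>\<^sup>+y. B x y \<partial>M) \<le> ennreal (1 / 2) * ennreal ((cmod (g x))\<^sup>2)" .
  qed
  also have "\<dots> = ennreal (1 / 2 * (L2norm M g)\<^sup>2)"
    by (subst nn_integral_cmult) (auto simp: nn_integral_L2norm[OF g] ennreal_mult[symmetric] simp del: ennreal_half)
  finally have "ennreal ((L2norm M g)\<^sup>2) \<le> ennreal (C\<^sup>2 / 2 * (L2norm M f)\<^sup>2 + 1 / 2 * (L2norm M g)\<^sup>2)"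
    by (simp add: ennreal_plus add_mono)
  then have "(L2norm M g)\<^sup>2 \<le> C\<^sup>2 / 2 * (L2norm M f)\<^sup>2 + 1 / 2 * (L2norm M g)\<^sup>2"
    by (subst (asm) ennreal_le_iff) auto
  \<comment> \<open>The term in \<open>g\<close> on the right is a finite real number, so it can be
    subtracted.\<close>
  then have "(L2norm M g)\<^sup>2 \<le> (C * L2norm M f)\<^sup>2" by (simp add: power_mult_distrib)
  then show ?thesis by (rule power2_le_imp_le) (use \<open>C > 0\<close> in simp)
qed

context bergman_space
begin

section \<open>Finite combinations of kernels\<close>

lemma kspan_Bspace: "f \<in> kspan \<Omega> \<sigma> K \<Longrightarrow> f \<in> Bspace \<Omega> \<sigma>"
proof -
  assume "f \<in> kspan \<Omega> \<sigma> K"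
  then obtain S c where "finite S" "S \<subseteq> \<Omega>" "f = (\<lambda>x. \<Sum>z\<in>S. c z * k z x)"
    by (auto simp: kspan_def)
  then show ?thesis
  proof (induction S arbitrary: f)
    case empty
    then show ?case using Bspace_mult[OF indicator_in_Bspace, of 0] by simp
  next
    case (insert u S)
    then show ?case
      using Bspace_lincomb[of "\<lambda>x. \<Sum>z\<in>S. c z * k z x" "k u" 1 "c u"] k_in_Bspace[of u]
      by (simp add: add.commute)
  qed
qed

lemma kspan_k: "z \<in> \<Omega> \<Longrightarrow> k z \<in> kspan \<Omega> \<sigma> K"
  unfolding kspan_def by (rule CollectI, rule exI[of _ "{z}"], rule exI[of _ "\<lambda>_. 1"]) auto

lemma kspan_lincomb:
  assumes "f \<in> kspan \<Omega> \<sigma> K" "g \<in> kspan \<Omega> \<sigma> K"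
  shows "(\<lambda>x. a * f x + b * g x) \<in> kspan \<Omega> \<sigma> K"
proof -
  obtain S c where S: "finite S" "S \<subseteq> \<Omega>" "f = (\<lambda>x. \<Sum>z\<in>S. c z * k z x)"
    using assms(1) by (auto simp: kspan_def)
  obtain S' c' where S': "finite S'" "S' \<subseteq> \<Omega>" "g = (\<lambda>x. \<Sum>z\<in>S'. c' z * k z x)"
    using assms(2) by (auto simp: kspan_def)
  define e where "e z = a * (if z \<in> S then c z else 0) + b * (if z \<in> S' then c' z else 0)" for z
  have "a * f x + b * g x = (\<Sum>z\<in>S \<union> S'. e z * k z x)" for x
  proof -
    have "f x = (\<Sum>z\<in>S \<union> S'. (if z \<in> S then c z else 0) * k z x)"
      unfolding S(3) using S S' by (intro sum.mono_neutral_cong_left) auto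
    moreover have "g x = (\<Sum>z\<in>S \<union> S'. (if z \<in> S' then c' z else 0) * k z x)"
      unfolding S'(3) using S S' by (intro sum.mono_neutral_cong_left) auto
    ultimately show ?thesis
      by (simp only: e_def sum_distrib_left sum.distrib[symmetric]) (simp only: algebra_simps)
  qed
  then show ?thesis
    unfolding kspan_def using S S' by (intro CollectI exI[of _ "S \<union> S'"] exI[of _ e]) auto
qed

text \<open>The step adds one kernel in the form \<open>1 * f x + c * k u x\<close>, the shape in
  which linearity of an operator on the span is stated.\<close>

lemma kspan_induct [consumes 1, case_names zero step]:
  assumes "f \<in> kspan \<Omega> \<sigma> K" and "P (\<lambda>_. 0)"
    and step: "\<And>f u c. f \<in> kspan \<Omega> \<sigma> K \<Longrightarrow> P f \<Longrightarrow> u \<in> \<Omega> \<Longrightarrow> P (\<lambda>x. 1 * f x + c * k u x)"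
  shows "P f"
proof -
  obtain S c where "finite S" "S \<subseteq> \<Omega>" "f = (\<lambda>x. \<Sum>z\<in>S. c z * k z x)"
    using assms(1) by (auto simp: kspan_def)
  then show ?thesis
  proof (induction S arbitrary: f)
    case empty
    then show ?case using assms(2) by simp
  next
    case (insert u S)
    have "(\<lambda>x. \<Sum>z\<in>S. c z * k z x) \<in> kspan \<Omega> \<sigma> K"
      using insert by (auto simp: kspan_def)
    then show ?case
      using step[of "\<lambda>x. \<Sum>z\<in>S. c z * k z x" u "c u"] insert by (simp add: add.commute)
  qed
qed

section \<open>Norm limits and density of the span\<close>

lemma inner_tendsto:
  assumes s: "\<And>n::nat. s n \<in> Lsq \<sigma>" and g: "g \<in> Lsq \<sigma>" and h: "h \<in> Lsq \<sigma>"
    and lim: "(\<lambda>n. L2norm \<sigma> (\<lambda>x. s n x - g x)) \<longlonglongrightarrow> 0"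
  shows "(\<lambda>n. L2inner \<sigma> (s n) h) \<longlonglongrightarrow> L2inner \<sigma> g h"
proof (rule LIM_zero_cancel, rule Lim_null_comparison)
  show "\<forall>\<^sub>F n in sequentially. norm (L2inner \<sigma> (s n) h - L2inner \<sigma> g h) \<le> L2norm \<sigma> (\<lambda>x. s n x - g x) * L2norm \<sigma> h"
    using L2_Cauchy_Schwarz[OF Lsq_diff[OF s g] h] by (simp add: L2inner_diff_left s g h)
  show "(\<lambda>n. L2norm \<sigma> (\<lambda>x. s n x - g x) * L2norm \<sigma> h) \<longlonglongrightarrow> 0"
    using tendsto_mult_right[OF lim, of "L2norm \<sigma> h"] by simp
qed

text \<open>Evaluation at \<open>z\<close> is the inner product with \<open>K z\<close>, hence
  continuous for the norm.\<close>

lemma Bspace_tendsto_pointwise: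
  assumes "\<And>n::nat. s n \<in> Bspace \<Omega> \<sigma>" "g \<in> Bspace \<Omega> \<sigma>" "z \<in> \<Omega>"
    and "(\<lambda>n. L2norm \<sigma> (\<lambda>x. s n x - g x)) \<longlonglongrightarrow> 0"
  shows "(\<lambda>n. s n z) \<longlonglongrightarrow> g z"
  using inner_tendsto[of s g "K z"] assms by (simp add: Bspace_Lsq reproducing K_in_Bspace)

text \<open>A minimizing sequence for the distance to the span is Cauchy by the parallelogram law, and its
  limit agrees with the function pointwise because the residuals become orthogonal to the kernels.\<close>

lemma kspan_dense:
  assumes f: "f \<in> Bspace \<Omega> \<sigma>"
  obtains s where "\<And>n::nat. s n \<in> kspan \<Omega> \<sigma> K" "(\<lambda>n. L2norm \<sigma> (\<lambda>x. s n x - f x)) \<longlonglongrightarrow> 0"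
proof -
  define V where "V = (\<lambda>s. (L2norm \<sigma> (\<lambda>x. f x - s x))\<^sup>2) ` kspan \<Omega> \<sigma> K"
  have bdd: "bdd_below V" by (auto simp: V_def intro!: bdd_belowI[of _ 0])
  have "V \<noteq> {}" using kspan_k[OF zero_in_domain] by (auto simp: V_def)
  have "\<exists>s\<in>kspan \<Omega> \<sigma> K. (L2norm \<sigma> (\<lambda>x. f x - s x))\<^sup>2 < Inf V + inverse (real (Suc n))" for n
    using cInf_lessD[OF \<open>V \<noteq> {}\<close>, of "Inf V + inverse (real (Suc n))"] by (auto simp: V_def)
  then obtain s where s: "\<And>n. s n \<in> kspan \<Omega> \<sigma> K"
      and s_near: "\<And>n. (L2norm \<sigma> (\<lambda>x. f x - s n x))\<^sup>2 < Inf V + inverse (real (Suc n))"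
    by metis
  have min: "Inf V \<le> (L2norm \<sigma> (\<lambda>x. f x - t x))\<^sup>2" if "t \<in> kspan \<Omega> \<sigma> K" for t
    using that by (intro cInf_lower bdd) (auto simp: V_def)
  define e where "e n = (\<lambda>x. f x - s n x)" for n
  have sB: "s n \<in> Bspace \<Omega> \<sigma>" for n by (rule kspan_Bspace[OF s])
  have eB: "e n \<in> Bspace \<Omega> \<sigma>" for n unfolding e_def by (intro Bspace_diff f sB)
  have eL: "e n \<in> Lsq \<sigma>" for n by (rule Bspace_Lsq[OF eB])
  have e_near: "(L2norm \<sigma> (e n))\<^sup>2 < Inf V + inverse (real (Suc n))" for n
    using s_near by (simp add: e_def)
  have cauchy: "(L2norm \<sigma> (\<lambda>x. s m x - s n x))\<^sup>2 \<le> 2 * inverse (real (Suc m)) + 2 * inverse (real (Suc n))" for m n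
  proof -
    have 1: "(L2norm \<sigma> (\<lambda>x. s m x - s n x))\<^sup>2
        = (L2norm \<sigma> (e n))\<^sup>2 + (L2norm \<sigma> (e m))\<^sup>2 - 2 * Re (L2inner \<sigma> (e n) (e m))"
      using L2norm_square_lincomb[OF eL[of n] eL[of m], of 1 "-1"] by (simp add: e_def)
    have half: "f x = 1/2 * f x + 1/2 * f x" for x by simp
    \<comment> \<open>The midpoint of \<open>s m\<close> and \<open>s n\<close> lies in the span, so
      its squared distance to \<open>f\<close> is at least \<open>Inf V\<close>. This bounds the
      real part of the inner product in fact \<open>1\<close> from below.\<close>
    have "(\<lambda>x. 1/2 * e n x + 1/2 * e m x) = (\<lambda>x. f x - (1/2 * s m x + 1/2 * s n x))"
      by (rule ext, subst half) (simp add: e_def algebra_simps)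
    then have "Inf V \<le> (L2norm \<sigma> (\<lambda>x. 1/2 * e n x + 1/2 * e m x))\<^sup>2"
      using min[OF kspan_lincomb[OF s[of m] s[of n], of "1/2" "1/2"]] by simp
    also have "\<dots> = (L2norm \<sigma> (e n))\<^sup>2 / 4 + (L2norm \<sigma> (e m))\<^sup>2 / 4 + Re (L2inner \<sigma> (e n) (e m)) / 2"
      using L2norm_square_lincomb[OF eL[of n] eL[of m], of "1/2" "1/2"]
      by (simp add: power2_eq_square)
    finally show ?thesis using 1 e_near[of m] e_near[of n] by linarith
  qed
  obtain g where g: "g \<in> Bspace \<Omega> \<sigma>" and lim: "(\<lambda>n. L2norm \<sigma> (\<lambda>x. s n x - g x)) \<longlonglongrightarrow> 0"
  proof (rule Bspace_complete[OF sB])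
    fix r :: real assume "r > 0"
    then obtain n0 where n0: "inverse (real (Suc n0)) < r\<^sup>2 / 4"
      using reals_Archimedean[of "r\<^sup>2 / 4"] by auto
    have "L2norm \<sigma> (\<lambda>x. s m x - s n x) < r" if "m \<ge> n0" "n \<ge> n0" for m n
    proof -
      have "inverse (real (Suc m)) \<le> inverse (real (Suc n0))" "inverse (real (Suc n)) \<le> inverse (real (Suc n0))"
        using that by (simp_all add: field_simps)
      then have "(L2norm \<sigma> (\<lambda>x. s m x - s n x))\<^sup>2 < r\<^sup>2"
        using cauchy[of m n] n0 by linarith
      then show ?thesis using \<open>r > 0\<close> by (meson less_eq_real_def power2_less_imp_less)
    qed
    then show "\<exists>N. \<forall>m\<ge>N. \<forall>n\<ge>N. L2norm \<sigma> (\<lambda>x. s m x - s n x) < r" by blast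
  qed
  have "f = g"
  proof
    fix z
    show "f z = g z"
    proof (cases "z \<in> \<Omega>")
      case z: True
      have "(\<lambda>n. s n z) \<longlonglongrightarrow> f z"
      proof (rule LIM_zero_cancel, rule Lim_null_comparison)
        have "cmod (s n z - f z) \<le> N z * sqrt (inverse (real (Suc n)))" for n
        proof -
          \<comment> \<open>Adding \<open>?c * k z\<close> to \<open>s n\<close> stays in the span
            and lowers the squared distance by the squared modulus of \<open>?c\<close>, while less
            than \<open>1 / (n + 1)\<close> is left above the infimum. Up to the factor
            \<open>N z\<close>, \<open>?c\<close> is the error at \<open>z\<close>.\<close>
          let ?c = "L2inner \<sigma> (e n) (k z)"
          have "(\<lambda>x. 1 * e n x + (- ?c) * k z x) = (\<lambda>x. f x - (1 * s n x + ?c * k z x))"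
            by (simp add: e_def algebra_simps)
          then have "Inf V \<le> (L2norm \<sigma> (\<lambda>x. 1 * e n x + (- ?c) * k z x))\<^sup>2"
            using min[OF kspan_lincomb[OF s[of n] kspan_k[OF z], of 1 ?c]] by simp
          then have "(cmod ?c)\<^sup>2 \<le> inverse (real (Suc n))"
            using L2norm_square_residual[OF eL Bspace_Lsq[OF k_in_Bspace[OF z]] L2norm_k[OF z], of n] e_near[of n]
            by linarith
          then have "cmod ?c \<le> sqrt (inverse (real (Suc n)))" by (rule real_le_rsqrt)
          moreover have "cmod (s n z - f z) = N z * cmod ?c"
            using inner_k[OF z eB[of n]] N_pos[OF z] by (simp add: norm_divide e_def norm_minus_commute)
          ultimately show ?thesis by (simp add: mult_left_mono)
        qed
        then show "\<forall>\<^sub>F n in sequentially. norm (s n z - f z) \<le> N z * sqrt (inverse (real (Suc n)))" by simp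
        have "(\<lambda>n. N z * sqrt (inverse (real (Suc n)))) \<longlonglongrightarrow> N z * sqrt 0"
          by (intro tendsto_intros LIMSEQ_inverse_real_of_nat)
        then show "(\<lambda>n. N z * sqrt (inverse (real (Suc n)))) \<longlonglongrightarrow> 0" by simp
      qed
      then show ?thesis
        using Bspace_tendsto_pointwise[OF sB g z lim] by (rule LIMSEQ_unique)
    next
      case False
      then show ?thesis using Bspace_zero f g by metis
    qed
  qed
  then show ?thesis using that s lim by blast
qed

end

section \<open>Boundedness\<close>

theorem theorem3p1:
  fixes \<Omega> :: "(complex^'n::finite) set"
    and \<phi> :: "complex^'n \<Rightarrow> complex^'n \<Rightarrow> complex^'n"
    and d :: "complex^'n \<Rightarrow> complex^'n \<Rightarrow> real"
    and \<sigma> :: "(complex^'n) measure"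
    and K :: "complex^'n \<Rightarrow> complex^'n \<Rightarrow> complex"
    and \<kappa> p :: real
    and T Tstar :: "(complex^'n \<Rightarrow> complex) \<Rightarrow> (complex^'n \<Rightarrow> complex)"
  assumes B: "bergman_type \<Omega> \<phi> d \<sigma> K \<kappa>"
    and T_into: "\<forall>f\<in>kspan \<Omega> \<sigma> K. T f \<in> Bspace \<Omega> \<sigma>"
    and T_lin: "\<forall>f\<in>kspan \<Omega> \<sigma> K. \<forall>g\<in>kspan \<Omega> \<sigma> K. \<forall>a b.
                  T (\<lambda>x. a * f x + b * g x) = (\<lambda>x. a * T f x + b * T g x)"
    and Ts_into: "\<forall>f\<in>kspan \<Omega> \<sigma> K. Tstar f \<in> Bspace \<Omega> \<sigma>"
    and Ts_lin: "\<forall>f\<in>kspan \<Omega> \<sigma> K. \<forall>g\<in>kspan \<Omega> \<sigma> K. \<forall>a b.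
                  Tstar (\<lambda>x. a * f x + b * g x) = (\<lambda>x. a * Tstar f x + b * Tstar g x)"
    and adj: "\<forall>z\<in>\<Omega>. \<forall>w\<in>\<Omega>.
                L2inner \<sigma> (T (nkernel \<sigma> K z)) (nkernel \<sigma> K w)
              = L2inner \<sigma> (nkernel \<sigma> K z) (Tstar (nkernel \<sigma> K w))"
    and p: "p > (4 - \<kappa>) / (2 - \<kappa>)"
    and supT: "(SUP z\<in>\<Omega>. \<integral>\<^sup>+ w. ennreal (cmod (transl \<sigma> K \<phi> z (T (nkernel \<sigma> K z)) w) powr p) \<partial>\<sigma>) < \<infinity>"
    and supTs: "(SUP z\<in>\<Omega>. \<integral>\<^sup>+ w. ennreal (cmod (transl \<sigma> K \<phi> z (Tstar (nkernel \<sigma> K z)) w) powr p) \<partial>\<sigma>) < \<infinity>"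
  shows "\<exists>S. (\<forall>f\<in>Bspace \<Omega> \<sigma>. S f \<in> Bspace \<Omega> \<sigma>) \<and>
             (\<forall>f\<in>Bspace \<Omega> \<sigma>. \<forall>g\<in>Bspace \<Omega> \<sigma>. \<forall>a b.
                 S (\<lambda>x. a * f x + b * g x) = (\<lambda>x. a * S f x + b * S g x)) \<and>
             (\<exists>C. \<forall>f\<in>Bspace \<Omega> \<sigma>. L2norm \<sigma> (S f) \<le> C * L2norm \<sigma> f) \<and>
             (\<forall>f\<in>kspan \<Omega> \<sigma> K. S f = T f)"
proof -

  \<comment> \<open>Row and column estimates\<close>
  interpret bergman_space \<Omega> \<phi> d \<sigma> K \<kappa> by unfold_locales (rule B)
  define q where "q = p / (p - 1)"
  obtain a where pq: "p > 2" "1 < q" "q < 2" "1 / p + 1 / q = 1"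
    and exponent: "if \<kappa> > 0 then 2 - a > \<kappa> \<and> \<kappa> > 2 - 2 * q + a \<and> 2 - 2 * q + a > 0
     else 2 - a = 2 - 2 * q + a \<and> 2 - 2 * q + a > 0"
    by (rule Rudin_Forelli_exponent[OF kappa_bounds p q_def]) blast
  have Tk: "T (k z) \<in> Bspace \<Omega> \<sigma>" and Tsk: "Tstar (k z) \<in> Bspace \<Omega> \<sigma>" if "z \<in> \<Omega>" for z
    using T_into Ts_into kspan_k[OF that] by blast+
  obtain C1 where C1: "C1 > 0" "\<And>z. z \<in> \<Omega> \<Longrightarrow>
    (\<integral>\<^sup>+ w. ennreal (N z * cmod (T (k z) w) * Nm w powr (a / q)) \<partial>\<sigma>) \<le> ennreal (C1 * Nm z powr (a / q))"
    by (rule Schur_estimate[where G="\<lambda>z. T (k z)", OF pq exponent Tk supT]) blast+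
  obtain C2 where C2: "C2 > 0" "\<And>z. z \<in> \<Omega> \<Longrightarrow>
    (\<integral>\<^sup>+ w. ennreal (N z * cmod (Tstar (k z) w) * Nm w powr (a / q)) \<partial>\<sigma>) \<le> ennreal (C2 * Nm z powr (a / q))"
    by (rule Schur_estimate[where G="\<lambda>z. Tstar (k z)", OF pq exponent Tsk supTs]) blast+
  define C where "C = max C1 C2"
  have "C > 0" using C1(1) by (simp add: C_def)

  \<comment> \<open>This is \<open>Tstar\<close> applied to the unnormalized kernel, expressed
    through \<open>k z\<close>, the function the hypotheses speak of.\<close>
  define \<tau> where "\<tau> z = (\<lambda>w. complex_of_real (N z) * Tstar (k z) w)" for z
  have \<tau>B: "\<tau> z \<in> Bspace \<Omega> \<sigma>" if "z \<in> \<Omega>" for z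
    unfolding \<tau>_def by (intro Bspace_mult Tsk that)
  have inner_\<tau>: "L2inner \<sigma> f (\<tau> z) = complex_of_real (N z) * L2inner \<sigma> f (Tstar (k z))" for f z
    unfolding \<tau>_def L2inner_def integral_mult_right_zero[symmetric] by (simp add: algebra_simps)
  have Tk_inner: "T (k u) z = L2inner \<sigma> (k u) (\<tau> z)" if "u \<in> \<Omega>" "z \<in> \<Omega>" for u z
  proof -
    have "T (k u) z = complex_of_real (N z) * L2inner \<sigma> (T (k u)) (k z)"
      using inner_k[OF that(2) Tk[OF that(1)]] N_pos[OF that(2)] by simp
    then show ?thesis using adj that by (simp add: inner_\<tau>)
  qed
  \<comment> \<open>For kernels this is the adjoint relation together with the reproducing property;
    linearity carries it over to the span.\<close>
  have T_inner: "T f z = L2inner \<sigma> f (\<tau> z)" if "f \<in> kspan \<Omega> \<sigma> K" "z \<in> \<Omega>" for f z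
    using that(1)
  proof (induction f rule: kspan_induct)
    case zero
    \<comment> \<open>Linearity with zero coefficients gives the value of \<open>T\<close> at the
      zero function; \<open>k 0\<close> is merely some element of the span.\<close>
    have "T (\<lambda>x. 0 * k 0 x + 0 * k 0 x) = (\<lambda>x. 0 * T (k 0) x + 0 * T (k 0) x)"
      using T_lin kspan_k[OF zero_in_domain] by blast
    then show ?case by (simp add: L2inner_def)
  next
    case (step f u c)
    have "T (\<lambda>x. 1 * f x + c * k u x) = (\<lambda>x. 1 * T f x + c * T (k u) x)"
      using T_lin kspan_k[OF step(2)] step(1) by blast
    moreover have "L2inner \<sigma> (\<lambda>x. 1 * f x + c * k u x) (\<tau> z) = 1 * L2inner \<sigma> f (\<tau> z) + c * L2inner \<sigma> (k u) (\<tau> z)"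
      using step that(2) by (intro L2inner_lincomb_left Bspace_Lsq kspan_Bspace kspan_k \<tau>B)
    ultimately show ?case using step Tk_inner[OF step(2) that(2)] by simp
  qed
  \<comment> \<open>The same integral kernel read from the other variable: \<open>Tstar\<close>
    supplies its rows and \<open>T\<close> its columns, so each supremum hypothesis gives one of the
    two Schur bounds.\<close>
  have \<tau>_swap: "cnj (\<tau> z w) = complex_of_real (N w) * T (k w) z" if "z \<in> \<Omega>" "w \<in> \<Omega>" for z w
    using Tk_inner[OF that(2,1)] inner_k[OF that(2) \<tau>B[OF that(1)]] N_pos[OF that(2)]
    by (simp add: L2inner_commute[of \<sigma> "k w" "\<tau> z"])

  \<comment> \<open>Cut off in \<open>z\<close>, since nothing is known about
    \<open>\<tau> z\<close> outside the domain. Joint measurability comes from continuity in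
    \<open>z\<close>, visible through \<open>T\<close>, and measurability in \<open>w\<close>,
    visible through \<open>Tstar\<close>.\<close>
  define F where "F z w = (if z \<in> \<Omega> then cnj (\<tau> z w) else 0)" for z w
  have "(\<lambda>(z, w). F z w) \<in> borel_measurable (borel \<Otimes>\<^sub>M borel)"
    unfolding F_def
  proof (rule borel_measurable_pair_continuous)
    show "open \<Omega>" "\<Omega> \<noteq> {}" using open_domain zero_in_domain by auto
    show "continuous_on \<Omega> (\<lambda>z. cnj (\<tau> z w))" for w
    proof (cases "w \<in> \<Omega>")
      case True
      have "continuous_on \<Omega> (\<lambda>z. complex_of_real (N w) * T (k w) z)"
        by (intro continuous_intros Bspace_continuous Tk True)
      then show ?thesis by (rule continuous_on_eq) (simp add: \<tau>_swap True)
    next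
      case False
      have "continuous_on \<Omega> (\<lambda>z. 0 :: complex)" by simp
      then show ?thesis
        by (rule continuous_on_eq) (simp add: Bspace_zero[OF \<tau>B False])
    qed
    show "(\<lambda>w. cnj (\<tau> z w)) \<in> borel_measurable borel" if "z \<in> \<Omega>" for z
      using Bspace_measurable[OF \<tau>B[OF that]] by measurable
  qed
  then have F_meas: "(\<lambda>(z, w). cmod (F z w)) \<in> borel_measurable (\<sigma> \<Otimes>\<^sub>M \<sigma>)"
    by (subst measurable_cong_sets[OF sets_pair_measure_cong[OF sets_sigma sets_sigma] refl])
      (simp add: case_prod_beta)

  \<comment> \<open>Boundedness on the span\<close>
  have bounded: "L2norm \<sigma> (T f) \<le> C * L2norm \<sigma> f" if f: "f \<in> kspan \<Omega> \<sigma> K" for f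
  proof (rule Schur_test[where F="\<lambda>z w. cmod (F z w)" and h="\<lambda>w. Nm w powr (a / q)"])
    show "sigma_finite_measure \<sigma>"
      using finite_sigma by (simp add: finite_measure_def)
    show "(\<lambda>(z, w). cmod (F z w)) \<in> borel_measurable (\<sigma> \<Otimes>\<^sub>M \<sigma>)" by (rule F_meas)
    show "(\<lambda>w. Nm w powr (a / q)) \<in> borel_measurable \<sigma>" unfolding measurable_sigma by measurable
    show "Nm w powr (a / q) > 0" for w using Nm_pos[of w] by simp
    show "AE z in \<sigma>. (\<integral>\<^sup>+ w. ennreal (cmod (F z w) * Nm w powr (a / q)) \<partial>\<sigma>) \<le> ennreal (C * Nm z powr (a / q))"
      using AE_in_domain
    proof eventually_elim
      fix z assume z: "z \<in> \<Omega>"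
      have "(\<integral>\<^sup>+ w. ennreal (cmod (F z w) * Nm w powr (a / q)) \<partial>\<sigma>) \<le> ennreal (C2 * Nm z powr (a / q))"
        using C2(2)[OF z] z by (simp add: F_def \<tau>_def norm_mult)
      also have "\<dots> \<le> ennreal (C * Nm z powr (a / q))"
        by (intro ennreal_leI mult_right_mono) (auto simp: C_def)
      finally show "(\<integral>\<^sup>+ w. ennreal (cmod (F z w) * Nm w powr (a / q)) \<partial>\<sigma>) \<le> ennreal (C * Nm z powr (a / q))" .
    qed
    show "AE w in \<sigma>. (\<integral>\<^sup>+ z. ennreal (cmod (F z w) * Nm z powr (a / q)) \<partial>\<sigma>) \<le> ennreal (C * Nm w powr (a / q))"
      using AE_in_domain
    proof eventually_elim
      fix w assume w: "w \<in> \<Omega>"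
      have "(\<integral>\<^sup>+ z. ennreal (cmod (F z w) * Nm z powr (a / q)) \<partial>\<sigma>)
          = (\<integral>\<^sup>+ z. ennreal (N w * cmod (T (k w) z) * Nm z powr (a / q)) \<partial>\<sigma>)"
      proof (rule nn_integral_cong_AE, use AE_in_domain in eventually_elim)
        fix z assume "z \<in> \<Omega>"
        then have "cmod (F z w) = N w * cmod (T (k w) z)"
          using \<tau>_swap[of z w] w by (simp add: F_def norm_mult del: complex_mod_cnj)
        then show "ennreal (cmod (F z w) * Nm z powr (a / q)) = ennreal (N w * cmod (T (k w) z) * Nm z powr (a / q))"
          by simp
      qed
      also have "\<dots> \<le> ennreal (C1 * Nm w powr (a / q))" by (rule C1(2)[OF w])
      also have "\<dots> \<le> ennreal (C * Nm w powr (a / q))"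
        by (intro ennreal_leI mult_right_mono) (auto simp: C_def)
      finally show "(\<integral>\<^sup>+ z. ennreal (cmod (F z w) * Nm z powr (a / q)) \<partial>\<sigma>) \<le> ennreal (C * Nm w powr (a / q))" .
    qed
    show "f \<in> Lsq \<sigma>" by (intro Bspace_Lsq kspan_Bspace f)
    show "T f \<in> Lsq \<sigma>" using T_into f by (intro Bspace_Lsq) blast
    \<comment> \<open>The inner product formula exhibits \<open>T f\<close> as an integral operator,
      and the modulus goes inside.\<close>
    show "AE z in \<sigma>. ennreal (cmod (T f z)) \<le> (\<integral>\<^sup>+ w. ennreal (cmod (F z w) * cmod (f w)) \<partial>\<sigma>)"
      using AE_in_domain
    proof eventually_elim
      fix z assume z: "z \<in> \<Omega>"
      have int: "integrable \<sigma> (\<lambda>w. f w * cnj (\<tau> z w))"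
        by (intro integrable_mult_cnj Bspace_Lsq kspan_Bspace f \<tau>B z)
      have "ennreal (cmod (T f z)) \<le> (\<integral>\<^sup>+ w. ennreal (norm (f w * cnj (\<tau> z w))) \<partial>\<sigma>)"
        unfolding T_inner[OF f z] L2inner_def by (rule integral_norm_bound_ennreal[OF int])
      then show "ennreal (cmod (T f z)) \<le> (\<integral>\<^sup>+ w. ennreal (cmod (F z w) * cmod (f w)) \<partial>\<sigma>)"
        using z by (simp add: F_def norm_mult mult.commute)
    qed
  qed (use \<open>C > 0\<close> in auto)

  \<comment> \<open>The extension to the whole space\<close>
  define S where "S f = (\<lambda>z. if z \<in> \<Omega> then L2inner \<sigma> f (\<tau> z) else 0)" for f
  \<comment> \<open>Off the domain both sides are 0: \<open>S f\<close> by its default value,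
    \<open>T f\<close> as a member of the space.\<close>
  have S_eq: "S f = T f" if f: "f \<in> kspan \<Omega> \<sigma> K" for f
  proof -
    have "T f \<in> Bspace \<Omega> \<sigma>" using T_into f by blast
    then show ?thesis
      by (intro ext) (simp add: S_def T_inner[OF f, symmetric] Bspace_zero)
  qed
  \<comment> \<open>That \<open>S f\<close> is holomorphic and square integrable is not visible from
    its formula. It is identified with the norm limit \<open>g\<close> of \<open>T (s n)\<close>,
    which lies in the space by completeness.\<close>
  have S_Bspace: "S f \<in> Bspace \<Omega> \<sigma> \<and> L2norm \<sigma> (S f) \<le> C * L2norm \<sigma> f" if f: "f \<in> Bspace \<Omega> \<sigma>" for f
  proof -
    obtain s where s: "\<And>n::nat. s n \<in> kspan \<Omega> \<sigma> K"
      and lim: "(\<lambda>n. L2norm \<sigma> (\<lambda>x. s n x - f x)) \<longlonglongrightarrow> 0"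
      by (rule kspan_dense[OF f]) blast
    have sB: "s n \<in> Bspace \<Omega> \<sigma>" for n by (rule kspan_Bspace[OF s])
    have TsB: "T (s n) \<in> Bspace \<Omega> \<sigma>" for n using T_into s by blast
    note L = Bspace_Lsq
    have Tdiff: "L2norm \<sigma> (\<lambda>x. T (s m) x - T (s n) x)
        \<le> C * (L2norm \<sigma> (\<lambda>x. s m x - f x) + L2norm \<sigma> (\<lambda>x. s n x - f x))" for m n
    proof -
      have "T (\<lambda>x. 1 * s m x + (-1) * s n x) = (\<lambda>x. 1 * T (s m) x + (-1) * T (s n) x)"
        using T_lin s by blast
      then have "L2norm \<sigma> (\<lambda>x. T (s m) x - T (s n) x) \<le> C * L2norm \<sigma> (\<lambda>x. s m x - s n x)"
        using bounded[OF kspan_lincomb[OF s[of m] s[of n], of 1 "-1"]] by simp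
      also have "L2norm \<sigma> (\<lambda>x. s m x - s n x) \<le> L2norm \<sigma> (\<lambda>x. s m x - f x) + L2norm \<sigma> (\<lambda>x. f x - s n x)"
        using L2norm_triangle[OF Lsq_diff[OF L[OF sB[of m]] L[OF f]] Lsq_diff[OF L[OF f] L[OF sB[of n]]]]
        by simp
      finally show ?thesis
        using \<open>C > 0\<close> by (simp add: L2norm_minus_commute[of \<sigma> f "s n"] mult_left_mono)
    qed
    obtain g where g: "g \<in> Bspace \<Omega> \<sigma>" and limT: "(\<lambda>n. L2norm \<sigma> (\<lambda>x. T (s n) x - g x)) \<longlonglongrightarrow> 0"
    proof (rule Bspace_complete[OF TsB])
      fix r :: real assume "r > 0"
      then have "r / (2 * C) > 0" using \<open>C > 0\<close> by simp
      from LIMSEQ_D[OF lim this] obtain n0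
        where n0: "\<And>n. n \<ge> n0 \<Longrightarrow> L2norm \<sigma> (\<lambda>x. s n x - f x) < r / (2 * C)" by auto
      have "L2norm \<sigma> (\<lambda>x. T (s m) x - T (s n) x) < r" if "m \<ge> n0" "n \<ge> n0" for m n
      proof -
        have "L2norm \<sigma> (\<lambda>x. s m x - f x) + L2norm \<sigma> (\<lambda>x. s n x - f x) < r / C"
          using n0[OF that(1)] n0[OF that(2)] by simp
        then have "C * (L2norm \<sigma> (\<lambda>x. s m x - f x) + L2norm \<sigma> (\<lambda>x. s n x - f x)) < r"
          using \<open>C > 0\<close> by (simp add: less_divide_eq mult.commute)
        then show ?thesis using Tdiff[of m n] by linarith
      qed
      then show "\<exists>N. \<forall>m\<ge>N. \<forall>n\<ge>N. L2norm \<sigma> (\<lambda>x. T (s m) x - T (s n) x) < r" by blast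
    qed
    \<comment> \<open>At a point of the domain \<open>T (s n)\<close> has two limits: the value of
      \<open>g\<close>, by continuity of evaluation, and the inner product defining
      \<open>S f\<close>, by continuity in the first argument.\<close>
    have "S f = g"
    proof
      fix z
      show "S f z = g z"
      proof (cases "z \<in> \<Omega>")
        case z: True
        have "(\<lambda>n. T (s n) z) \<longlonglongrightarrow> g z"
          by (rule Bspace_tendsto_pointwise[OF TsB g z limT])
        moreover have "(\<lambda>n. T (s n) z) \<longlonglongrightarrow> L2inner \<sigma> f (\<tau> z)"
          unfolding T_inner[OF s z] by (rule inner_tendsto[OF L[OF sB] L[OF f] L[OF \<tau>B[OF z]] lim])
        ultimately show ?thesis using z by (simp add: S_def LIMSEQ_unique)
      next
        case False
        then show ?thesis using Bspace_zero[OF g] by (simp add: S_def)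
      qed
    qed
    moreover have "L2norm \<sigma> g \<le> C * L2norm \<sigma> f"
    proof (rule LIMSEQ_le_const)
      \<comment> \<open>Two triangle inequalities and the bound on the span put
        \<open>L2norm \<sigma> g\<close> below every term of this sequence.\<close>
      show "(\<lambda>n. L2norm \<sigma> (\<lambda>x. T (s n) x - g x) + C * (L2norm \<sigma> (\<lambda>x. s n x - f x) + L2norm \<sigma> f))
          \<longlonglongrightarrow> C * L2norm \<sigma> f"
        by (rule tendsto_eq_intros limT lim refl | simp)+
      have "L2norm \<sigma> g \<le> L2norm \<sigma> (\<lambda>x. T (s n) x - g x) + C * (L2norm \<sigma> (\<lambda>x. s n x - f x) + L2norm \<sigma> f)" for n
      proof -
        have "L2norm \<sigma> g \<le> L2norm \<sigma> (\<lambda>x. g x - T (s n) x) + L2norm \<sigma> (T (s n))"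
          using L2norm_triangle[OF Lsq_diff[OF L[OF g] L[OF TsB]] L[OF TsB], of n n] by simp
        moreover have "L2norm \<sigma> (s n) \<le> L2norm \<sigma> (\<lambda>x. s n x - f x) + L2norm \<sigma> f"
          using L2norm_triangle[OF Lsq_diff[OF L[OF sB] L[OF f]] L[OF f], of n] by simp
        then have "L2norm \<sigma> (T (s n)) \<le> C * (L2norm \<sigma> (\<lambda>x. s n x - f x) + L2norm \<sigma> f)"
          using bounded[OF s[of n]] \<open>C > 0\<close> by (meson mult_left_mono less_imp_le order_trans)
        ultimately show ?thesis by (simp add: L2norm_minus_commute[of \<sigma> g])
      qed
      then show "\<exists>N. \<forall>n\<ge>N. L2norm \<sigma> g \<le> L2norm \<sigma> (\<lambda>x. T (s n) x - g x)
          + C * (L2norm \<sigma> (\<lambda>x. s n x - f x) + L2norm \<sigma> f)" by blast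
    qed
    ultimately show ?thesis using g by simp
  qed
  \<comment> \<open>The formula for \<open>S\<close> involves no approximating sequence, so
    linearity is inherited from the inner product.\<close>
  have S_lin: "S (\<lambda>x. a * f x + b * g x) = (\<lambda>x. a * S f x + b * S g x)"
    if "f \<in> Bspace \<Omega> \<sigma>" "g \<in> Bspace \<Omega> \<sigma>" for f g a b
    using L2inner_lincomb_left[OF that[THEN Bspace_Lsq] Bspace_Lsq[OF \<tau>B]] by (auto simp: S_def)
  show ?thesis
    using S_Bspace S_lin S_eq by (intro exI[of _ S] conjI exI[of _ C] ballI allI) auto
qed

end
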